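(* There exist absolute positive constants $c_0, C_0, C_1$ such that the following holds. Let $\mathbf v_1,\dots,\mathbf v_M\in\mathbb{C}^N$ be a system of vectors such that $$\sum_{j=1}^M|\langle\mathbf w,\mathbf v_j\rangle|^2=\|\mathbf w\|_2^2\qquad\text{for all }\mathbf w\in\mathbb{C}^N,$$ and let $\theta$ be a real number with $\theta\le M/N$ and $$\|\mathbf v_j\|_2^2\le\theta N/M,\qquad j=1,\dots,M .$$ Then there is a subset $J\subset\{1,2,\dots,M\}$ with $|J|\le C_1\theta N$ such that for all $\mathbf w\in\mathbb{C}^N$ $$c_0\theta\|\mathbf w\|_2^2\le\frac MN\sum_{j\in J}|\langle\mathbf w,\mathbf v_j\rangle|^2\le C_0\theta\|\mathbf w\|_2^2 .$$
   Context: $\langle\cdot,\cdot\rangle$ and $\|\cdot\|_2$ are the standard inner product and Euclidean norm on $\mathbb{C}^N$, $N\ge1$. "Absolute" means that the constants do not depend on $M,N,\theta$ or the vectors. *)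

theory Defs
  imports "Jordan_Normal_Form.Matrix" "HOL-Analysis.L2_Norm"
begin

text \<open>
  The constants of the theorem have to be uniform in the dimension \<open>N\<close>, which is therefore
  quantified inside the formula: \<open>\<complex>\<^sup>N\<close> is \<open>carrier_vec N\<close>, a set of vectors with
  coordinates \<open>0, \<dots>, N - 1\<close>, and its standard inner product is \<open>(\<bullet>c)\<close>
  (conjugate-linear in the second argument).
\<close>

definition euclid_norm :: "complex vec \<Rightarrow> real" where
  "euclid_norm v = L2_set (\<lambda>i. cmod (v $ i)) {0..<dim_vec v}"

lemma euclid_norm_power2:
  "complex_of_real ((euclid_norm v)\<^sup>2) = v \<bullet>c v"
proof -
  have "(euclid_norm v)\<^sup>2 = (\<Sum>i\<in>{0..<dim_vec v}. (cmod (v $ i))\<^sup>2)"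
    unfolding euclid_norm_def L2_set_def by (simp add: sum_nonneg)
  then show ?thesis
    by (simp only: of_real_sum complex_norm_square) (simp add: scalar_prod_def)
qed

end

theory Submission
  imports Defs "HOL-Computational_Algebra.Computational_Algebra" "Jordan_Normal_Form.Determinant"
begin

text \<open>
  The proof is an elementary version of the argument of Marcus, Spielman and Srivastava, followed by
  repeated halving. For vectors with frame operator \<open>B\<close>, the function
  \<open>P(y, z) = det (\<Sum> y\<^sub>j v\<^sub>j v\<^sub>j\<^sup>*) det (\<Sum> z\<^sub>j v\<^sub>j v\<^sub>j\<^sup>*)\<close> is multiaffine and has no zeros when all
  variables have positive imaginary part, and this is preserved by the operators \<open>1 - \<alpha> \<partial>\<^sub>a - \<beta> \<partial>\<^sub>b\<close>
  with \<open>\<alpha>, \<beta> \<ge> 0\<close>. Putting \<open>2 v\<^sub>j v\<^sub>j\<^sup>*\<close> into the first or the second block at random amounts to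
  applying \<open>1 - \<partial>/\<partial>y\<^sub>j - \<partial>/\<partial>z\<^sub>j\<close>; since all convex combinations of the two outcomes are real-rooted, some choice has
  its largest root no larger than that of the average. The barrier argument bounds the latter root; as
  everything is quadratic in the direction \<open>\<partial>/\<partial>y\<^sub>j + \<partial>/\<partial>z\<^sub>j\<close>, the required convexity of the barrier
  functions reduces to the Rayleigh inequality \<open>p \<partial>\<^sub>a\<partial>\<^sub>b p \<le> \<partial>\<^sub>a p \<partial>\<^sub>b p\<close> at real points.
  This splits the vectors into two parts, each with sum at most \<open>(1 + \<eta>)\<^sup>2 / 2\<close> times \<open>B\<close>, where
  \<open>\<eta>\<close> has the order of the largest norm of a vector relative to \<open>B\<close>. Keeping the smaller part and repeating, the
  errors add up geometrically until the frame bounds are comparable to \<open>\<theta> N / M\<close>.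
\<close>

subsection \<open>Stable multiaffine polynomials\<close>

text \<open>A difference with step 1, which equals the partial derivative once the function is
  affine in \<open>e\<close>. It involves no limits and serves complex and real functions
  alike.\<close>

definition pdiff :: "'e \<Rightarrow> (('e \<Rightarrow> 'k::comm_ring_1) \<Rightarrow> 'k) \<Rightarrow> ('e \<Rightarrow> 'k) \<Rightarrow> 'k" where
  "pdiff e p y = p (y(e := y e + 1)) - p y"

definition multiaffine :: "(('e \<Rightarrow> 'k::comm_ring_1) \<Rightarrow> 'k) \<Rightarrow> bool" where
  "multiaffine p \<longleftrightarrow> (\<forall>e y s. p (y(e := y e + s)) = p y + s * pdiff e p y)"

lemma multiaffineD: "multiaffine p \<Longrightarrow> p (y(e := y e + s)) = p y + s * pdiff e p y"
  by (simp add: multiaffine_def)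

lemma multiaffine_upd:
  assumes "multiaffine p"
  shows "p (y(e := s)) = p y + (s - y e) * pdiff e p y"
  using multiaffineD[OF assms, of y e "s - y e"] by simp

lemma pdiff_upd_same:
  assumes "multiaffine p"
  shows "pdiff e p (y(e := s)) = pdiff e p y"
proof -
  have "pdiff e p (y(e := s)) = p (y(e := s + 1)) - p (y(e := s))"
    by (simp add: pdiff_def)
  also have "\<dots> = pdiff e p y"
    by (simp only: multiaffine_upd[OF assms, of y e]) (simp add: algebra_simps)
  finally show ?thesis .
qed

lemma pdiff_commute: "pdiff a (pdiff b p) y = pdiff b (pdiff a p) y"
  by (cases "a = b") (simp_all add: pdiff_def fun_upd_twist)

lemma multiaffine_pdiff:
  assumes "multiaffine p"
  shows "multiaffine (pdiff a p)"
  unfolding multiaffine_def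
proof (intro allI)
  fix e y s
  show "pdiff a p (y(e := y e + s)) = pdiff a p y + s * pdiff e (pdiff a p) y"
  proof (cases "e = a")
    case True
    have "pdiff a (pdiff a p) y = 0"
      by (simp add: pdiff_def[of a "pdiff a p"] pdiff_upd_same[OF assms])
    then show ?thesis using True by (simp add: pdiff_upd_same[OF assms])
  next
    case False
    have "pdiff a p (y(e := y e + s))
        = p ((y(a := y a + 1))(e := (y(a := y a + 1)) e + s)) - p (y(e := y e + s))"
      using False by (simp add: pdiff_def fun_upd_twist)
    also have "\<dots> = pdiff a p y + s * (pdiff e p (y(a := y a + 1)) - pdiff e p y)"
      by (simp only: multiaffineD[OF assms]) (simp add: pdiff_def algebra_simps)
    also have "pdiff e p (y(a := y a + 1)) - pdiff e p y = pdiff e (pdiff a p) y"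
      by (subst pdiff_commute) (simp add: pdiff_def[of a "pdiff e p"])
    finally show ?thesis .
  qed
qed

lemma multiaffine_lincomb:
  assumes "multiaffine p" "multiaffine q"
  shows "multiaffine (\<lambda>y. c * p y + d * q y)"
  unfolding multiaffine_def
proof (intro allI)
  fix e y s
  show "c * p (y(e := y e + s)) + d * q (y(e := y e + s))
    = c * p y + d * q y + s * pdiff e (\<lambda>y. c * p y + d * q y) y"
    by (simp only: multiaffineD[OF assms(1)] multiaffineD[OF assms(2)])
       (simp add: pdiff_def algebra_simps)
qed

text \<open>Polynomials are represented by their evaluation functions. The last clause says that on every
  line in the direction \<open>(1, \<dots>, 1)\<close> the function has degree \<open>n\<close> and leading coefficient \<open>L\<close>.\<close>

definition stable_poly :: "nat \<Rightarrow> real \<Rightarrow> (('e \<Rightarrow> complex) \<Rightarrow> complex) \<Rightarrow> bool" where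
  "stable_poly n L P \<longleftrightarrow> multiaffine P \<and> (\<forall>y. P (\<lambda>e. cnj (y e)) = cnj (P y)) \<and>
     (\<forall>y. (\<forall>e. Im (y e) > 0) \<longrightarrow> P y \<noteq> 0) \<and>
     (\<forall>u. \<exists>f. degree f \<le> n \<and> coeff f n = of_real L \<and> (\<forall>x. P (\<lambda>e. u e + x) = poly f x))"

text \<open>For multiaffine \<open>p\<close> and \<open>\<beta> = 0\<close> this is the substitution
  of \<open>y a - \<alpha>\<close> for \<open>y a\<close>. The operators with
  \<open>\<alpha>, \<beta> \<ge> 0\<close> and fixed sum \<open>\<alpha> + \<beta>\<close> are
  therefore the convex combinations of two shifts.\<close>

definition diff_op :: "'e \<Rightarrow> 'e \<Rightarrow> 'k \<Rightarrow> 'k \<Rightarrow> (('e \<Rightarrow> 'k::comm_ring_1) \<Rightarrow> 'k) \<Rightarrow> ('e \<Rightarrow> 'k) \<Rightarrow> 'k" where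
  "diff_op a b \<alpha> \<beta> p y = p y - \<alpha> * pdiff a p y - \<beta> * pdiff b p y"

text \<open>As a function of the variable \<open>a\<close> alone, \<open>P\<close> is affine with
  zero at \<open>y a + s\<close>, where \<open>s = - P y / pdiff a P y\<close>. Stability forces
  \<open>Im s < 0\<close>, and the logarithmic derivative is \<open>- 1 / s\<close>.\<close>

lemma Im_pdiff_le:
  assumes P: "multiaffine P" and nz: "\<And>y. (\<And>e. Im (y e) > 0) \<Longrightarrow> P y \<noteq> 0"
    and y: "\<And>e. Im (y e) > 0" and d: "pdiff a P y \<noteq> 0"
  shows "Im (pdiff a P y / P y) < 0"
proof -
  define s where "s = - P y / pdiff a P y"
  have s0: "P (y(a := y a + s)) = 0"
    unfolding multiaffineD[OF P] using d by (simp add: s_def)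
  have "Im s < 0"
  proof (rule ccontr)
    assume "\<not> Im s < 0"
    then have "P (y(a := y a + s)) \<noteq> 0"
      using y by (intro nz) (auto simp: add_pos_nonneg)
    with s0 show False by simp
  qed
  moreover have "pdiff a P y / P y = - inverse s"
    using d by (simp add: s_def field_simps)
  moreover have "s \<noteq> 0" using \<open>Im s < 0\<close> by auto
  ultimately show ?thesis by (simp add: divide_neg_pos sum_power2_gt_zero_iff complex_eq_iff)
qed

lemma multiaffine_diff_op:
  assumes "multiaffine P"
  shows "multiaffine (diff_op a b \<alpha> \<beta> P)"
proof -
  have "diff_op a b \<alpha> \<beta> P
    = (\<lambda>y. 1 * (1 * P y + (-\<alpha>) * pdiff a P y) + (-\<beta>) * pdiff b P y)"
    by (simp add: diff_op_def fun_eq_iff)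
  then show ?thesis
    by (simp only:) (intro multiaffine_lincomb multiaffine_pdiff assms)
qed

text \<open>A zero would give \<open>1 = \<alpha> * A + \<beta> * B\<close> with logarithmic
  derivatives \<open>A\<close>, \<open>B\<close> that are 0 or lie in the open lower half-plane.
  Taking imaginary parts shows that both terms vanish, a contradiction.\<close>

lemma stable_poly_diff_op:
  assumes P: "stable_poly n L P" and "\<alpha> \<ge> 0" "\<beta> \<ge> 0"
  shows "stable_poly n L (diff_op a b (complex_of_real \<alpha>) (complex_of_real \<beta>) P)"
proof -
  have aff: "multiaffine P" and conj: "\<And>y. P (\<lambda>e. cnj (y e)) = cnj (P y)"
    and nz: "\<And>y. (\<And>e. Im (y e) > 0) \<Longrightarrow> P y \<noteq> 0"
    and diag: "\<And>u. \<exists>f. degree f \<le> n \<and> coeff f n = of_real L \<and> (\<forall>x. P (\<lambda>e. u e + x) = poly f x)"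
    using P unfolding stable_poly_def by auto
  have pdiff_cnj: "pdiff e P (\<lambda>e. cnj (y e)) = cnj (pdiff e P y)" for e y
  proof -
    have "(\<lambda>e. cnj (y e))(e := cnj (y e) + 1) = (\<lambda>x. cnj ((y(e := y e + 1)) x))"
      by auto
    then show ?thesis
      unfolding pdiff_def by (simp only: conj complex_cnj_diff)
  qed
  have "diff_op a b (of_real \<alpha>) (of_real \<beta>) P y \<noteq> 0" if y: "\<And>e. Im (y e) > 0" for y
  proof
    assume 0: "diff_op a b (of_real \<alpha>) (of_real \<beta>) P y = 0"
    have Py: "P y \<noteq> 0" using nz y by blast
    define A where "A = pdiff a P y / P y"
    define B where "B = pdiff b P y / P y"
    have "1 = of_real \<alpha> * A + of_real \<beta> * B"
    proof -
      have "1 = (P y - diff_op a b (of_real \<alpha>) (of_real \<beta>) P y) / P y"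
        using Py 0 by simp
      then show ?thesis by (simp add: diff_op_def A_def B_def add_divide_distrib)
    qed
    then have 1: "\<alpha> * Im A + \<beta> * Im B = 0" "\<alpha> * Re A + \<beta> * Re B = 1"
      by (simp_all add: complex_eq_iff)
    have AB: "A = 0 \<or> Im A < 0" "B = 0 \<or> Im B < 0"
      using Im_pdiff_le[OF aff nz y] by (auto simp: A_def B_def)
    then have "\<alpha> * Im A \<le> 0" "\<beta> * Im B \<le> 0"
      using assms(2,3) by (auto simp: mult_nonneg_nonpos)
    with 1 have "\<alpha> * Im A = 0" "\<beta> * Im B = 0" by linarith+
    with AB have "\<alpha> * Re A = 0" "\<beta> * Re B = 0" by auto
    with 1 show False by simp
  qed
  moreover have "\<exists>f. degree f \<le> n \<and> coeff f n = of_real L \<and>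
    (\<forall>x. diff_op a b (of_real \<alpha>) (of_real \<beta>) P (\<lambda>e. u e + x) = poly f x)" for u
  proof -
    obtain f where f: "degree f \<le> n" "coeff f n = of_real L" "\<And>x. P (\<lambda>e. u e + x) = poly f x"
      using diag[of u] by auto
    have "\<exists>f. degree f \<le> n \<and> coeff f n = of_real L \<and> 
        (\<forall>x. P ((\<lambda>e. u e + x)(c := u c + x + 1)) = poly f x)" for c
    proof -
      have "(\<lambda>e. u e + x)(c := u c + x + 1) = (\<lambda>e. (u(c := u c + 1)) e + x)" for x
        by auto
      then show ?thesis using diag[of "u(c := u c + 1)"] by simp
    qed
    from this[of a] this[of b] obtain g h where
      g: "degree g \<le> n" "coeff g n = of_real L" "\<And>x. P ((\<lambda>e. u e + x)(a := u a + x + 1)) = poly g x" and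
      h: "degree h \<le> n" "coeff h n = of_real L" "\<And>x. P ((\<lambda>e. u e + x)(b := u b + x + 1)) = poly h x"
      by blast
    \<comment> \<open>\<open>f\<close>, \<open>g\<close> and \<open>h\<close> share the coefficient
      \<open>L\<close> in degree \<open>n\<close>, so the two differences do not change it.\<close>
    let ?r = "f - smult (of_real \<alpha>) (g - f) - smult (of_real \<beta>) (h - f)"
    have "degree ?r \<le> n"
      using f g h by (intro degree_diff_le order.trans[OF degree_smult_le]) auto
    then show ?thesis
      using f g h by (intro exI[of _ ?r]) (simp add: diff_op_def pdiff_def)
  qed
  moreover have "diff_op a b (of_real \<alpha>) (of_real \<beta>) P (\<lambda>e. cnj (y e))
      = cnj (diff_op a b (of_real \<alpha>) (of_real \<beta>) P y)" for y
    by (simp add: diff_op_def pdiff_cnj conj)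
  ultimately show ?thesis
    unfolding stable_poly_def by (simp add: multiaffine_diff_op[OF aff])
qed

subsection \<open>Choice in an interlacing family\<close>

definition pos_real :: "complex \<Rightarrow> bool" where
  "pos_real z \<longleftrightarrow> z \<in> \<real> \<and> Re z > 0"

lemma coeff_real_rooted:
  fixes f :: "complex poly"
  assumes lc: "lead_coeff f \<in> \<real>" and roots: "\<And>z. poly f z = 0 \<Longrightarrow> z \<in> \<real>"
  shows "coeff f k \<in> \<real>"
proof -
  have "\<forall>z \<in># R. z \<in> \<real> \<Longrightarrow> coeff (\<Prod>x\<in>#R. [:-x, 1:]) k \<in> \<real>" for R :: "complex multiset" and k
  proof (induction R arbitrary: k)
    case empty
    then show ?case by (cases k) auto
  next
    case (add x R)
    then show ?case by (cases k) (auto simp: coeff_pCons mult_pCons_left intro!: Reals_mult)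
  qed
  moreover have "\<forall>z \<in># proots f. z \<in> \<real>"
    using roots by (cases "f = 0") auto
  ultimately have "coeff (smult (lead_coeff f) (\<Prod>x\<in>#proots f. [:-x, 1:])) k \<in> \<real>"
    using lc by (auto intro!: Reals_mult)
  then show ?thesis by (simp only: complex_poly_decompose_multiset)
qed

text \<open>Every linear factor \<open>X - x\<close> has positive coefficients, and products
  preserve this up to the degree.\<close>

lemma coeff_neg_rooted:
  fixes f :: "complex poly"
  assumes lc: "pos_real (lead_coeff f)" and roots: "\<And>z. poly f z = 0 \<Longrightarrow> pos_real (- z)"
    and k: "k \<le> degree f"
  shows "pos_real (coeff f k)"
proof -
  have pr: "pos_real (a * b)" "pos_real (a + b)" if "pos_real a" "pos_real b" for a b
    using that by (auto simp: pos_real_def complex_is_Real_iff)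
  have *: "\<forall>z \<in># R. pos_real (- z) \<Longrightarrow> k \<le> size R \<Longrightarrow> pos_real (coeff (\<Prod>x\<in>#R. [:-x, 1:]) k)" for R k
  proof (induction R arbitrary: k)
    case empty
    then show ?case by (auto simp: pos_real_def)
  next
    case (add x R)
    let ?q = "\<Prod>x\<in>#R. [:-x, 1:]"
    have IH: "k \<le> size R \<Longrightarrow> pos_real (coeff ?q k)" for k using add by auto
    have x: "pos_real (-x)" using add by auto
    have z: "coeff ?q k = 0" if "k > size R" for k
    proof -
      have "degree ?q \<le> size R"
      proof (induction R)
        case (add x R)
        have "degree (\<Prod>x\<in>#add_mset x R. [:- x, 1:]) \<le> degree [:-x,1:] + degree (\<Prod>x\<in>#R. [:- x, 1:])"
          by (simp only: image_mset_add_mset prod_mset.add_mset degree_mult_le)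
        then show ?case using add by auto
      qed auto
      then show ?thesis using that by (intro coeff_eq_0) auto
    qed
    show ?case
    proof (cases k)
      case 0
      then show ?thesis using pr(1)[OF x IH[of 0]] by simp
    next
      case (Suc k')
      have "coeff (\<Prod>x\<in>#add_mset x R. [:- x, 1:]) k = (- x) * coeff ?q k + coeff ?q k'"
        using Suc by simp
      moreover have "pos_real (coeff ?q k')" using add.prems Suc by (intro IH) auto
      moreover have "coeff ?q k = 0 \<or> pos_real (coeff ?q k)"
        using z IH by (cases "k \<le> size R") auto
      ultimately show ?thesis using pr(1)[OF x] pr(2) by (metis add.left_neutral mult_zero_right)
    qed
  qed
  have "f \<noteq> 0" using lc by (auto simp: pos_real_def)
  then have "\<forall>z \<in># proots f. pos_real (- z)" using roots by auto
  then have "pos_real (lead_coeff f * coeff (\<Prod>x\<in>#proots f. [:-x, 1:]) k)"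
    using k * lc by (intro pr) (auto simp: size_proots_complex)
  also have "lead_coeff f * coeff (\<Prod>x\<in>#proots f. [:-x, 1:]) k 
    = coeff (smult (lead_coeff f) (\<Prod>x\<in>#proots f. [:-x, 1:])) k" by simp
  finally show ?thesis by (simp only: complex_poly_decompose_multiset)
qed

text \<open>A continuity argument with finitely many critical parameters: at the largest zero
  \<open>t\<close> of those affine functions that start below 0, all of them are nonnegative, and
  \<open>strict\<close> contradicts the vanishing of one. Strict positivity is then
  \<open>strict\<close> at \<open>t = 0\<close>.\<close>

lemma affine_family_pos:
  fixes a b :: "nat \<Rightarrow> real"
  assumes b: "\<And>k. k \<le> n \<Longrightarrow> b k > 0"
    and strict: "\<And>t. \<lbrakk>0 \<le> t; t \<le> 1; \<And>k. k \<le> n \<Longrightarrow> (1 - t) * a k + t * b k \<ge> 0\<rbrakk> \<Longrightarrow>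
       (\<And>k. k \<le> n \<Longrightarrow> (1 - t) * a k + t * b k > 0)"
    and k: "k \<le> n"
  shows "a k > 0"
proof -
  have *: "a k \<ge> 0" if k: "k \<le> n" for k
  proof (rule ccontr)
    assume ak: "\<not> a k \<ge> 0"
    \<comment> \<open>The zero of \<open>(1 - t) * a k + t * b k\<close> as a function of
      \<open>t\<close>. The default 0 cannot win the maximum, since some \<open>a k\<close> is
      negative.\<close>
    define T where "T k = (if a k < 0 then - a k / (b k - a k) else 0)" for k
    define t where "t = Max (T ` {..n})"
    have "t \<in> T ` {..n}" unfolding t_def by (intro Max_in) auto
    then obtain m where m: "m \<le> n" "t = T m" by auto
    have Tle: "T k \<le> t" if "k \<le> n" for k using that unfolding t_def by (intro Max_ge) auto
    have T01: "0 \<le> T k" "T k \<le> 1" if "k \<le> n" for k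
      using b[OF that] by (auto simp: T_def divide_simps)
    have "T k > 0" using ak b[OF k] by (auto simp: T_def intro!: divide_neg_pos)
    then have t0: "t > 0" using Tle[OF k] by simp
    have am: "a m < 0" using t0 m by (auto simp: T_def split: if_splits)
    have nn: "(1 - t) * a k + t * b k \<ge> 0" if k: "k \<le> n" for k
    proof (cases "a k < 0")
      case True
      have "- a k / (b k - a k) \<le> t" using Tle[OF k] True by (simp add: T_def)
      then have "- a k \<le> t * (b k - a k)" using b[OF k] True by (subst (asm) pos_divide_le_eq) auto
      then show ?thesis by (simp add: algebra_simps)
    next
      case False
      then show ?thesis using b[OF k] T01[OF m(1)] m(2) by auto
    qed
    have "(1 - t) * a m + t * b m > 0"
      using strict[of t m] nn T01[OF m(1)] m by auto
    moreover have "t * (b m - a m) = - a m" using m am b[OF m(1)] by (simp add: T_def)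
    ultimately show False by (simp add: algebra_simps)
  qed
  show ?thesis using strict[of 0 k] * k by auto
qed

text \<open>The coefficients of a real-rooted polynomial without roots in \<open>[0, \<infinity>)\<close> are positive, and
  nonnegative coefficients with positive constant term exclude such roots. As the coefficients are affine
  in the parameter \<open>t\<close>, this makes the absence of roots persist along the whole segment.\<close>

lemma interlacing_half:
  fixes f g :: "complex poly"
  assumes deg: "degree f \<le> n" "degree g \<le> n" and lc: "coeff f n = of_real L" "coeff g n = of_real L" "L > 0"
    and rr: "\<And>t z. 0 \<le> t \<Longrightarrow> t \<le> 1 \<Longrightarrow> (1 - of_real t) * poly f z + of_real t * poly g z = 0 \<Longrightarrow> z \<in> \<real>"
    and g: "\<And>x. x \<ge> 0 \<Longrightarrow> poly g (of_real x) \<noteq> 0"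
    and f0: "Re (poly f 0) > 0" and x: "x \<ge> 0"
  shows "poly f (of_real x) \<noteq> 0"
proof -
  define h where "h t = smult (1 - of_real t) f + smult (of_real t) g" for t
  have ch: "coeff (h t) k = (1 - of_real t) * coeff f k + of_real t * coeff g k" for t k
    by (simp add: h_def)
  have chn: "coeff (h t) n = of_real L" for t
    using lc by (simp add: ch algebra_simps)
  have deg': "degree (h t) = n" for t
  proof (rule antisym)
    show "degree (h t) \<le> n" unfolding h_def
      using deg by (intro degree_add_le order.trans[OF degree_smult_le]) auto
    show "n \<le> degree (h t)" using chn[of t] lc by (intro le_degree) auto
  qed
  have rrh: "z \<in> \<real>" if "0 \<le> t" "t \<le> 1" "poly (h t) z = 0" for t z
    using rr[of t z] that by (simp add: h_def)
  have h01: "h 0 = f" "h 1 = g" by (simp_all add: h_def)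
  have real: "coeff (h t) k \<in> \<real>" if "0 \<le> t" "t \<le> 1" for t k
  proof (rule coeff_real_rooted)
    show "lead_coeff (h t) \<in> \<real>" by (simp add: deg' chn)
    show "z \<in> \<real>" if "poly (h t) z = 0" for z
      using rrh[OF \<open>0 \<le> t\<close> \<open>t \<le> 1\<close> that] .
  qed
  have pos: "pos_real (coeff (h t) k)" if t: "0 \<le> t" "t \<le> 1" and k: "k \<le> n"
     and nz: "\<And>x. x \<ge> 0 \<Longrightarrow> poly (h t) (of_real x) \<noteq> 0" for t k
  proof (rule coeff_neg_rooted)
    show "pos_real (lead_coeff (h t))" using lc by (simp add: deg' chn pos_real_def)
    show "k \<le> degree (h t)" using k by (simp add: deg')
    fix z assume z: "poly (h t) z = 0"
    then obtain r where "z = of_real r" using rrh t by (metis Reals_cases)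
    moreover have "r < 0" using nz[of r] z \<open>z = of_real r\<close> by (cases "r < 0") auto
    ultimately show "pos_real (-z)" by (simp add: pos_real_def)
  qed
  define a where "a k = Re (coeff f k)" for k
  define b where "b k = Re (coeff g k)" for k
  have nonv: "poly (h t) (of_real x) \<noteq> 0"
    if "0 \<le> t" "t \<le> 1" "x \<ge> 0" and nn: "\<And>k. k \<le> n \<Longrightarrow> (1 - t) * a k + t * b k \<ge> 0"
      and p0: "(1 - t) * a 0 + t * b 0 > 0" for t x
  proof -
    have r: "Re (coeff (h t) k) = (1 - t) * a k + t * b k" for k
      by (simp add: ch a_def b_def)
    have "Re (poly (h t) (of_real x)) = (\<Sum>k\<le>n. ((1 - t) * a k + t * b k) * x ^ k)"
      by (simp add: poly_altdef deg' r flip: of_real_power)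
    also have "\<dots> \<ge> (\<Sum>k\<in>{0}. ((1 - t) * a k + t * b k) * x ^ k)"
      using nn that by (intro sum_mono2) auto
    finally have "Re (poly (h t) (of_real x)) > 0" using p0 by simp
    then show ?thesis by auto
  qed
  have b: "b k > 0" if "k \<le> n" for k
    using pos[of 1 k] that g by (simp add: h01 b_def pos_real_def)
  have a0: "a 0 > 0" using f0 by (simp add: a_def poly_0_coeff_0)
  have p0: "(1 - t) * a 0 + t * b 0 > 0" if "0 \<le> t" "t \<le> 1" for t
  proof (cases "t = 0")
    case False
    then show ?thesis using a0 b[of 0] that by (intro add_nonneg_pos) auto
  qed (use a0 in auto)
  have "a k > 0" if "k \<le> n" for k
  proof (rule affine_family_pos[of n b a, OF b _ that])
    fix t k
    assume *: "0 \<le> t" "t \<le> 1" "\<And>k. k \<le> n \<Longrightarrow> 0 \<le> (1 - t) * a k + t * b k" and k: "k \<le> n"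
    have "pos_real (coeff (h t) k)"
      using * k p0 nonv by (intro pos) auto
    then show "0 < (1 - t) * a k + t * b k" by (simp add: pos_real_def ch a_def b_def)
  qed
  then show ?thesis using nonv[of 0 x] x a0 by (auto simp: h01 less_imp_le)
qed

text \<open>The average has positive leading coefficient and no root in
  \<open>[0, \<infinity>)\<close>, so it is positive at 0, and one of \<open>f\<close>,
  \<open>g\<close> has positive real part there. The segment from this one to the average is half of
  the segment between \<open>f\<close> and \<open>g\<close>, so \<open>interlacing_half\<close>
  applies.\<close>

lemma interlacing_choice:
  fixes f g :: "complex poly"
  assumes deg: "degree f \<le> n" "degree g \<le> n" and lc: "coeff f n = of_real L" "coeff g n = of_real L" "L > 0"
    and rr: "\<And>t z. 0 \<le> t \<Longrightarrow> t \<le> 1 \<Longrightarrow> (1 - of_real t) * poly f z + of_real t * poly g z = 0 \<Longrightarrow> z \<in> \<real>"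
    and avg: "\<And>x. x \<ge> 0 \<Longrightarrow> poly f (of_real x) + poly g (of_real x) \<noteq> 0"
  shows "(\<forall>x\<ge>0. poly f (of_real x) \<noteq> 0) \<or> (\<forall>x\<ge>0. poly g (of_real x) \<noteq> 0)"
proof -
  let ?h = "smult (1/2) (f + g)"
  have h: "degree ?h \<le> n" "coeff ?h n = of_real L"
    using deg lc by (auto intro: degree_add_le)
  have nz: "x \<ge> 0 \<Longrightarrow> poly ?h (of_real x) \<noteq> 0" for x using avg[of x] by simp
  have rrf: "z \<in> \<real>" if "0 \<le> t" "t \<le> 1" "(1 - of_real t) * poly f z + of_real t * poly ?h z = 0" for t z
    using that by (intro rr[of "t/2" z]) (auto simp: algebra_simps)
  have rrg: "z \<in> \<real>" if "0 \<le> t" "t \<le> 1" "(1 - of_real t) * poly g z + of_real t * poly ?h z = 0" for t z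
    using that by (intro rr[of "1 - t/2" z]) (auto simp: algebra_simps)
  have "Re (poly ?h 0) > 0"
  proof -
    have ld: "degree ?h = n" 
      using h lc(3) le_degree[of ?h n] by (intro antisym) auto
    have "pos_real (coeff ?h 0)"
    proof (rule coeff_neg_rooted)
      show "pos_real (lead_coeff ?h)" using h(2) lc(3) unfolding ld by (simp add: pos_real_def)
      fix z assume z: "poly ?h z = 0"
      then obtain r where "z = of_real r" using rrf[of 1 z] by (auto elim: Reals_cases)
      moreover have "r < 0" using nz[of r] z \<open>z = of_real r\<close> by (cases "r < 0") auto
    ultimately show "pos_real (-z)" by (simp add: pos_real_def)
    qed auto
    then show ?thesis by (simp add: pos_real_def poly_0_coeff_0)
  qed
  then have "Re (poly f 0) > 0 \<or> Re (poly g 0) > 0" by auto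
  then show ?thesis
  proof
    assume "Re (poly f 0) > 0"
    then have "\<forall>x\<ge>0. poly f (of_real x) \<noteq> 0"
      using interlacing_half[OF deg(1) h(1) lc(1) h(2) lc(3)] rrf nz by blast
    then show ?thesis ..
  next
    assume "Re (poly g 0) > 0"
    then have "\<forall>x\<ge>0. poly g (of_real x) \<noteq> 0"
      using interlacing_half[OF deg(2) h(1) lc(2) h(2) lc(3)] rrg nz by blast
    then show ?thesis ..
  qed
qed

lemma stable_polyD:
  assumes "stable_poly n L P"
  shows "multiaffine P" "\<And>y. P (\<lambda>e. cnj (y e)) = cnj (P y)"
    "\<And>y. (\<And>e. Im (y e) > 0) \<Longrightarrow> P y \<noteq> 0"
    "\<And>u. \<exists>f. degree f \<le> n \<and> coeff f n = of_real L \<and> (\<forall>x. P (\<lambda>e. u e + x) = poly f x)"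
  using assms unfolding stable_poly_def by auto

text \<open>A zero above the real axis contradicts stability directly, one below it after
  conjugation.\<close>

lemma stable_poly_real_rooted:
  assumes P: "stable_poly n L P" and 0: "P (\<lambda>e. of_real (u e) + z) = 0"
  shows "z \<in> \<real>"
proof (rule ccontr)
  assume "z \<notin> \<real>"
  then consider "Im z > 0" | "Im z < 0" using complex_is_Real_iff[of z] by linarith
  then show False
  proof cases
    case 1
    then show False using stable_polyD(3)[OF P, of "\<lambda>e. of_real (u e) + z"] 0 by simp
  next
    case 2
    then show False 
      using stable_polyD(2)[OF P, of "\<lambda>e. of_real (u e) + z"] 0
        stable_polyD(3)[OF P, of "\<lambda>e. cnj (of_real (u e) + z)"] by simp
  qed
qed

text \<open>The polynomial averaged over all choices, for each \<open>j\<close> in the list, of one of the two variables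
  \<open>(j, True)\<close> and \<open>(j, False)\<close>, which is then shifted by \<open>-2\<close>.\<close>

fun mixed :: "'a list \<Rightarrow> (('a \<times> bool \<Rightarrow> 'k::comm_ring_1) \<Rightarrow> 'k) \<Rightarrow> ('a \<times> bool \<Rightarrow> 'k) \<Rightarrow> 'k" where
  "mixed [] p = p"
| "mixed (j # js) p = mixed js (diff_op (j, True) (j, False) 1 1 p)"

lemma stable_poly_mixed: "stable_poly n L P \<Longrightarrow> stable_poly n L (mixed js P)"
proof (induction js arbitrary: P)
  case (Cons j js)
  show ?case
    using Cons.IH[OF stable_poly_diff_op[OF Cons.prems, of 1 1]] by simp
qed simp

lemma mixed_lincomb:
  "mixed js (\<lambda>y. c * p y + d * q y) = (\<lambda>y. c * mixed js p y + d * mixed js q y)"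
proof (induction js arbitrary: p q)
  case (Cons j js)
  have "diff_op (j, True) (j, False) 1 1 (\<lambda>y. c * p y + d * q y) =
    (\<lambda>y. c * diff_op (j, True) (j, False) 1 1 p y + d * diff_op (j, True) (j, False) 1 1 q y)"
    by (simp add: diff_op_def pdiff_def fun_eq_iff algebra_simps)
  then show ?case by (simp add: Cons.IH)
qed simp

text \<open>Induction decides one index at a time. The outcomes \<open>D 2 0\<close> and
  \<open>D 0 2\<close> for \<open>j\<close> have the average \<open>D 1 1\<close>, the operator
  inside \<open>mixed\<close>, and all their convex combinations are real-rooted after the remaining
  operators because these preserve stability.\<close>

lemma interlacing_family_choice:
  assumes P: "stable_poly n L P" and L: "L > 0" and js: "distinct js"
    and nz: "\<And>x. x \<ge> x0 \<Longrightarrow> mixed js P (\<lambda>_. of_real x) \<noteq> 0"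
  shows "\<exists>c. \<forall>x\<ge>x0. P (\<lambda>e. of_real x - (if fst e \<in> set js \<and> snd e = c (fst e) then 2 else 0)) \<noteq> 0"
  using P js nz
proof (induction js arbitrary: P)
  case Nil
  then show ?case by simp
next
  case (Cons j js)
  note P = Cons.prems(1)
  define D where "D s t = diff_op (j, True) (j, False) (of_real s) (of_real t) P" for s t
  have sD: "stable_poly n L (mixed js (D s t))" if "s \<ge> 0" "t \<ge> 0" for s t
    using stable_poly_mixed[OF stable_poly_diff_op[OF P that]] by (simp add: D_def)
  obtain f where f: "degree f \<le> n" "coeff f n = of_real L"
    "\<And>x. mixed js (D 2 0) (\<lambda>e. of_real x0 + x) = poly f x"
    using stable_polyD(4)[OF sD, of 2 0 "\<lambda>e. of_real x0"] by auto
  obtain g where g: "degree g \<le> n" "coeff g n = of_real L"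
    "\<And>x. mixed js (D 0 2) (\<lambda>e. of_real x0 + x) = poly g x"
    using stable_polyD(4)[OF sD, of 0 2 "\<lambda>e. of_real x0"] by auto
  have comb: "(1 - of_real t) * poly f z + of_real t * poly g z
      = mixed js (D (2 * (1 - t)) (2 * t)) (\<lambda>e. of_real x0 + z)" for t z
  proof -
    have "D (2 * (1 - t)) (2 * t) = (\<lambda>y. (1 - of_real t) * D 2 0 y + of_real t * D 0 2 y)"
      by (simp add: D_def diff_op_def fun_eq_iff algebra_simps)
    then show ?thesis by (simp only: mixed_lincomb f(3) g(3))
  qed
  have "(\<forall>x\<ge>0. poly f (of_real x) \<noteq> 0) \<or> (\<forall>x\<ge>0. poly g (of_real x) \<noteq> 0)"
  proof (rule interlacing_choice[OF f(1) g(1) f(2) g(2) L])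
    fix t :: real and z
    assume t: "0 \<le> t" "t \<le> 1" and 0: "(1 - of_real t) * poly f z + of_real t * poly g z = 0"
    show "z \<in> \<real>"
      using stable_poly_real_rooted[OF sD, of "2 * (1 - t)" "2 * t" "\<lambda>e. x0" z] t 0
      unfolding comb by simp
  next
    fix x :: real
    assume x: "x \<ge> 0"
    have "poly f (of_real x) + poly g (of_real x) = 2 * mixed js (D 1 1) (\<lambda>e. of_real x0 + of_real x)"
      using comb[of "1/2" "of_real x"] by (simp add: field_simps)
    also have "\<dots> \<noteq> 0"
      using Cons.prems(3)[of "x0 + x"] x by (simp add: D_def)
    finally show "poly f (of_real x) + poly g (of_real x) \<noteq> 0" .
  qed
  then obtain b where b: "\<And>x. x \<ge> x0 \<Longrightarrow> mixed js (if b then D 2 0 else D 0 2) (\<lambda>e. of_real x) \<noteq> 0"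
  proof
    assume *: "\<forall>x\<ge>0. poly f (of_real x) \<noteq> 0"
    have "mixed js (D 2 0) (\<lambda>e. of_real x) \<noteq> 0" if "x \<ge> x0" for x
      using *[rule_format, of "x - x0"] that by (simp flip: f(3))
    then show thesis using that[of True] by simp
  next
    assume *: "\<forall>x\<ge>0. poly g (of_real x) \<noteq> 0"
    have "mixed js (D 0 2) (\<lambda>e. of_real x) \<noteq> 0" if "x \<ge> x0" for x
      using *[rule_format, of "x - x0"] that by (simp flip: g(3))
    then show thesis using that[of False] by simp
  qed
  define Q where "Q = (if b then D 2 0 else D 0 2)"
  \<comment> \<open>Multiaffinity turns \<open>1 - 2 \<partial>\<close> in the variable
    \<open>(j, b)\<close> into a shift of that variable by \<open>-2\<close>.\<close>
  have Q: "Q y = P (y((j, b) := y (j, b) - 2))" for y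
    using multiaffineD[OF stable_polyD(1)[OF P], of y "(j, b)" "-2"]
    by (cases b) (simp_all add: Q_def D_def diff_op_def fun_upd_def)
  have "stable_poly n L Q"
    unfolding Q_def D_def using stable_poly_diff_op[OF P, of 2 0] stable_poly_diff_op[OF P, of 0 2]
    by (cases b) auto
  moreover have "distinct js" using Cons.prems by simp
  moreover have "mixed js Q (\<lambda>_. of_real x) \<noteq> 0" if "x \<ge> x0" for x
    using b[OF that] by (simp add: Q_def)
  ultimately obtain c where c: "\<And>x. x \<ge> x0 \<Longrightarrow>
      Q (\<lambda>e. of_real x - (if fst e \<in> set js \<and> snd e = c (fst e) then 2 else 0)) \<noteq> 0"
    using Cons.IH by blast
  have "P (\<lambda>e. of_real x - (if fst e \<in> set (j # js) \<and> snd e = (c(j := b)) (fst e) then 2 else 0)) \<noteq> 0"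
    if "x \<ge> x0" for x
  proof -
    have "j \<notin> set js" using Cons.prems by simp
    then have "(\<lambda>e. complex_of_real x - (if fst e \<in> set js \<and> snd e = c (fst e) then 2 else 0))
        ((j, b) := complex_of_real x - (if fst (j, b) \<in> set js \<and> snd (j, b) = c (fst (j, b)) then 2 else 0) - 2)
      = (\<lambda>e. of_real x - (if fst e \<in> set (j # js) \<and> snd e = (c(j := b)) (fst e) then 2 else 0))"
      by (auto simp: fun_eq_iff)
    then show ?thesis using c[OF that] unfolding Q by simp
  qed
  then show ?case by blast
qed

section \<open>Restriction to real points and the Rayleigh inequality\<close>

definition real_version :: "(('e \<Rightarrow> complex) \<Rightarrow> complex) \<Rightarrow> ('e \<Rightarrow> real) \<Rightarrow> real" where
  "real_version P y = Re (P (\<lambda>e. of_real (y e)))"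

text \<open>Where \<open>p\<close> is positive, this says that the mixed second derivatives of
  \<open>log p\<close> are nonpositive. The form without division also makes sense at zeros of
  \<open>p\<close>.\<close>

definition rayleigh :: "(('e \<Rightarrow> real) \<Rightarrow> real) \<Rightarrow> bool" where
  "rayleigh p \<longleftrightarrow> (\<forall>y a b. a \<noteq> b \<longrightarrow> p y * pdiff a (pdiff b p) y \<le> pdiff a p y * pdiff b p y)"

lemma of_real_upd:
  "(\<lambda>e. complex_of_real ((y(a := t)) e)) = (\<lambda>e. complex_of_real (y e))(a := complex_of_real t)"
  by auto

lemma pdiff_real_version:
  "pdiff a (real_version P) y = Re (pdiff a P (\<lambda>e. of_real (y e)))"
  unfolding pdiff_def real_version_def of_real_upd by simp

lemma real_version_diff_op:
  "real_version (diff_op a b 1 1 P) = diff_op a b 1 1 (real_version P)"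
proof
  fix y
  show "real_version (diff_op a b 1 1 P) y = diff_op a b 1 1 (real_version P) y"
    by (simp add: diff_op_def pdiff_real_version) (simp add: real_version_def diff_op_def)
qed

lemma multiaffine_real_version:
  assumes "multiaffine P" shows "multiaffine (real_version P)"
  unfolding multiaffine_def
proof (intro allI)
  fix e y s
  show "real_version P (y(e := y e + s)) = real_version P y + s * pdiff e (real_version P) y"
    using multiaffineD[OF assms, of "\<lambda>e. of_real (y e)" e "of_real s"]
    unfolding pdiff_real_version unfolding real_version_def of_real_upd
    by simp
qed

lemma real_version_eq:
  assumes "stable_poly n L P"
  shows "P (\<lambda>e. of_real (y e)) = of_real (real_version P y)"
  using stable_polyD(2)[OF assms, of "\<lambda>e. of_real (y e)"]
  by (simp add: real_version_def complex_eq_iff)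

lemma pdiff_real_version_eq:
  assumes "stable_poly n L P"
  shows "pdiff a P (\<lambda>e. of_real (y e)) = of_real (pdiff a (real_version P) y)"
  using real_version_eq[OF assms, of "y(a := y a + 1)"] real_version_eq[OF assms, of y]
  unfolding of_real_upd by (simp add: pdiff_def)

lemma pdiff2_real_version_eq:
  assumes "stable_poly n L P"
  shows "pdiff a (pdiff b P) (\<lambda>e. of_real (y e)) = of_real (pdiff a (pdiff b (real_version P)) y)"
  using pdiff_real_version_eq[OF assms, of b "y(a := y a + 1)"] pdiff_real_version_eq[OF assms, of b y]
  unfolding of_real_upd by (simp add: pdiff_def[of a])

text \<open>For \<open>y\<close> shifted by \<open>\<i>\<close> in the coordinate \<open>b\<close> and by \<open>\<i>\<epsilon>\<close> in all coordinates, the logarithmic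
  derivative in the direction \<open>a\<close> has nonpositive imaginary part; let \<open>\<epsilon>\<close> tend to \<open>0\<close>.\<close>

lemma rayleigh_real_version:
  assumes P: "stable_poly n L P"
  shows "rayleigh (real_version P)"
  unfolding rayleigh_def
proof (intro allI impI)
  fix y :: "'a \<Rightarrow> real" and a b :: 'a assume ab: "a \<noteq> b"
  let ?p = "real_version P"
  note aff = stable_polyD(1)[OF P]
  define u where "u = (\<lambda>e. complex_of_real (y e))(b := of_real (y b) + \<i>)"
  \<comment> \<open>It has the sign of the imaginary part of the logarithmic derivative, but stays
    continuous where \<open>P\<close> vanishes.\<close>
  define G where "G x = Im (pdiff a P (\<lambda>e. u e + x) * cnj (P (\<lambda>e. u e + x)))" for x
  obtain f where f: "\<And>x. P (\<lambda>e. u e + x) = poly f x"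
    using stable_polyD(4)[OF P, of u] by auto
  obtain g where g: "\<And>x. P (\<lambda>e. (u(a := u a + 1)) e + x) = poly g x"
    using stable_polyD(4)[OF P, of "u(a := u a + 1)"] by auto
  have pd: "pdiff a P (\<lambda>e. u e + x) = poly g x - poly f x" for x
  proof -
    have "(\<lambda>e. u e + x)(a := u a + x + 1) = (\<lambda>e. (u(a := u a + 1)) e + x)" by auto
    then show ?thesis by (simp only: pdiff_def f g)
  qed
  have neg: "G (\<i> * of_real \<epsilon>) \<le> 0" if "\<epsilon> > 0" for \<epsilon>
  proof (cases "pdiff a P (\<lambda>e. u e + \<i> * of_real \<epsilon>) = 0")
    case False
    let ?z = "\<lambda>e. u e + \<i> * of_real \<epsilon>"
    have Im: "Im (?z e) > 0" for e using that by (simp add: u_def)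
    have "Im (pdiff a P ?z / P ?z) < 0"
      by (rule Im_pdiff_le[OF aff stable_polyD(3)[OF P] Im False])
    moreover have "P ?z \<noteq> 0" by (rule stable_polyD(3)[OF P Im])
    ultimately show ?thesis unfolding G_def
      by (simp add: Im_complex_div_lt_0)
  qed (simp add: G_def)
  have "((\<lambda>\<epsilon>. G (\<i> * of_real \<epsilon>)) \<longlongrightarrow> G (\<i> * of_real 0)) (at_right 0)"
    unfolding G_def pd f by (intro tendsto_intros)
  then have lim: "((\<lambda>\<epsilon>. G (\<i> * of_real \<epsilon>)) \<longlongrightarrow> G 0) (at_right 0)"
    by simp
  have "G 0 \<le> 0"
    using tendsto_upperbound[OF lim, of 0] neg
    by (auto simp: eventually_at_right_less eventually_at_filter)
  \<comment> \<open>Expansion in the coordinate \<open>b\<close> is exact by multiaffinity;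
    \<open>G 0\<close> becomes the difference of the two sides of the Rayleigh inequality.\<close>
  moreover have "P u = of_real (?p y) + \<i> * of_real (pdiff b ?p y)"
    using multiaffineD[OF aff, of "\<lambda>e. of_real (y e)" b \<i>]
    by (simp add: u_def real_version_eq[OF P] pdiff_real_version_eq[OF P])
  moreover have "pdiff a P u = of_real (pdiff a ?p y) + \<i> * of_real (pdiff a (pdiff b ?p) y)"
    using multiaffineD[OF multiaffine_pdiff[OF aff], of a "\<lambda>e. of_real (y e)" b \<i>]
    by (simp add: u_def pdiff_real_version_eq[OF P] pdiff_commute[of b a] pdiff2_real_version_eq[OF P])
  ultimately show "?p y * pdiff a (pdiff b ?p) y \<le> pdiff a ?p y * pdiff b ?p y"
    by (simp add: G_def algebra_simps)
qed

subsection \<open>The barrier argument\<close>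

text \<open>The notion of lying above all zeros from the barrier method. Finite support of
  \<open>w\<close> lets a move be made one coordinate at a time.\<close>

definition above :: "(('e \<Rightarrow> real) \<Rightarrow> real) \<Rightarrow> ('e \<Rightarrow> real) \<Rightarrow> bool" where
  "above p y \<longleftrightarrow> (\<forall>w. finite {e. w e \<noteq> 0} \<longrightarrow> (\<forall>e. w e \<ge> 0) \<longrightarrow> p (\<lambda>e. y e + w e) > 0)"

lemma above_pos:
  assumes "above p y" shows "p y > 0"
proof -
  have "p (\<lambda>e. y e + (\<lambda>_. 0) e) > 0"
    using assms unfolding above_def by (rule allE[of _ "\<lambda>_. 0"]) simp
  then show ?thesis by simp
qed

lemma above_upd:
  assumes "above p y" "s \<ge> 0"
  shows "above p (y(e := y e + s))"
  unfolding above_def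
proof (intro allI impI)
  fix w :: "'a \<Rightarrow> real" assume w: "finite {e. w e \<noteq> 0}" "\<forall>e. w e \<ge> 0"
  let ?w = "w(e := w e + s)"
  have "{x. ?w x \<noteq> 0} \<subseteq> insert e {e. w e \<noteq> 0}" by auto
  then have "finite {x. ?w x \<noteq> 0}" using w(1) finite_subset by blast
  moreover have "\<forall>x. ?w x \<ge> 0" using w assms(2) by auto
  ultimately have "p (\<lambda>x. y x + ?w x) > 0" using assms(1) unfolding above_def by blast
  also have "(\<lambda>x. y x + ?w x) = (\<lambda>x. (y(e := y e + s)) x + w x)" by auto
  finally show "p (\<lambda>x. (y(e := y e + s)) x + w x) > 0" .
qed

lemma linear_nonneg_imp_slope:
  fixes a b :: real
  assumes "\<And>s. s \<ge> 0 \<Longrightarrow> a + s * b \<ge> 0"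
  shows "b \<ge> 0"
proof (rule ccontr)
  assume b: "\<not> b \<ge> 0"
  then have "a + ((\<bar>a\<bar> + 1) / (- b)) * b \<ge> 0" by (intro assms) (simp add: divide_nonneg_neg)
  moreover have "((\<bar>a\<bar> + 1) / (- b)) * b = - (\<bar>a\<bar> + 1)" using b by (simp add: field_simps)
  ultimately show False by linarith
qed

text \<open>An affine function that stays positive on a half-line has nonnegative slope.\<close>

lemma pdiff_nonneg:
  assumes "multiaffine p" "above p y"
  shows "pdiff a p y \<ge> 0"
proof (rule linear_nonneg_imp_slope)
  fix s :: real assume "s \<ge> 0"
  then have "p (y(a := y a + s)) > 0" by (rule above_pos[OF above_upd[OF assms(2)]])
  then show "p y + s * pdiff a p y \<ge> 0"
    unfolding multiaffineD[OF assms(1)] by (rule less_imp_le)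
qed

lemma pdiff2_nonneg:
  assumes "multiaffine p" "above p y"
  shows "pdiff a (pdiff b p) y \<ge> 0"
proof (rule linear_nonneg_imp_slope)
  fix s :: real assume "s \<ge> 0"
  then have "pdiff b p (y(a := y a + s)) \<ge> 0" by (rule pdiff_nonneg[OF assms(1) above_upd[OF assms(2)]])
  then show "pdiff b p y + s * pdiff a (pdiff b p) y \<ge> 0"
    unfolding multiaffineD[OF multiaffine_pdiff[OF assms(1)]] .
qed

definition barrier :: "'e \<Rightarrow> (('e \<Rightarrow> real) \<Rightarrow> real) \<Rightarrow> ('e \<Rightarrow> real) \<Rightarrow> real" where
  "barrier a p y = pdiff a p y / p y"

text \<open>Numerator and denominator are affine in the variable \<open>e\<close>, so
  cross-multiplication leaves only the Rayleigh inequality at \<open>y\<close>. For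
  \<open>e = a\<close> the second derivative vanishes.\<close>

lemma barrier_upd_le:
  assumes p: "multiaffine p" "rayleigh p" "above p y" and s: "s \<ge> 0"
  shows "barrier a p (y(e := y e + s)) \<le> barrier a p y"
proof -
  have pos: "p y > 0" "p y + s * pdiff e p y > 0"
    using above_pos[OF p(3)] above_pos[OF above_upd[OF p(3) s, of e]] 
    unfolding multiaffineD[OF p(1)] by auto
  have "p y * pdiff e (pdiff a p) y \<le> pdiff e p y * pdiff a p y"
  proof (cases "e = a")
    case True
    have "pdiff a (pdiff a p) y = 0"
      by (simp add: pdiff_def[of a "pdiff a p"] pdiff_upd_same[OF p(1)])
    then show ?thesis using True by simp
  next
    case False
    then show ?thesis using p(2) unfolding rayleigh_def by blast
  qed
  then have "s * (p y * pdiff e (pdiff a p) y) \<le> s * (pdiff e p y * pdiff a p y)"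
    using s by (rule mult_left_mono)
  then have "(pdiff a p y + s * pdiff e (pdiff a p) y) * p y \<le> pdiff a p y * (p y + s * pdiff e p y)"
    by (simp add: algebra_simps)
  then show ?thesis
    unfolding barrier_def multiaffineD[OF p(1)] multiaffineD[OF multiaffine_pdiff[OF p(1)]]
    using pos by (simp add: divide_le_eq pos_le_divide_eq field_simps)
qed

lemma barrier_mono:
  assumes p: "multiaffine p" "rayleigh p" "above p y"
    and w: "finite {e. w e \<noteq> 0}" "\<And>e. w e \<ge> 0"
  shows "barrier a p (\<lambda>e. y e + w e) \<le> barrier a p y"
proof -
  have "above p (\<lambda>e. y e + (if e \<in> S then w e else 0)) \<and>
      barrier a p (\<lambda>e. y e + (if e \<in> S then w e else 0)) \<le> barrier a p y" if "finite S" for S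
    using that
  proof (induction S)
    case (insert x S)
    let ?z = "\<lambda>e. y e + (if e \<in> S then w e else 0)"
    have "?z(x := ?z x + w x) = (\<lambda>e. y e + (if e \<in> insert x S then w e else 0))"
      using insert by auto
    then show ?case
      using above_upd[of p ?z "w x" x] barrier_upd_le[OF p(1,2), of ?z "w x" a x] insert w(2)[of x]
      by auto
  qed (use p in simp)
  from this[OF w(1)] have "barrier a p (\<lambda>e. y e + (if w e \<noteq> 0 then w e else 0)) \<le> barrier a p y"
    by simp
  also have "(\<lambda>e. y e + (if w e \<noteq> 0 then w e else 0)) = (\<lambda>e. y e + w e)" by auto
  finally show ?thesis .
qed

section \<open>Convexity of quotients of quadratics\<close>

lemma nonpos_quadratic_discrim:
  fixes w0 w1 w2 :: real
  assumes "\<And>t. w0 + w1 * t + w2 * t\<^sup>2 \<le> 0"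
  shows "w0 \<le> 0" "w2 \<le> 0" "w1\<^sup>2 \<le> 4 * w0 * w2"
proof -
  show w0: "w0 \<le> 0" using assms[of 0] by simp
  show w2: "w2 \<le> 0"
  proof (rule ccontr)
    assume w2: "\<not> w2 \<le> 0"
    define t where "t = (\<bar>w0\<bar> + \<bar>w1\<bar> + 1) / w2 + 1"
    have t: "t \<ge> 1" using w2 by (simp add: t_def)
    have "w2 * t = \<bar>w0\<bar> + \<bar>w1\<bar> + 1 + w2" using w2 by (simp add: t_def field_simps)
    then have "w2 * t + w1 \<ge> \<bar>w0\<bar> + 1" using w2 by linarith
    then have "t * (w2 * t + w1) \<ge> 1 * (\<bar>w0\<bar> + 1)" using t by (intro mult_mono) auto
    then show False using assms[of t] by (simp add: power2_eq_square algebra_simps)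
  qed
  show "w1\<^sup>2 \<le> 4 * w0 * w2"
  proof (cases "w2 = 0")
    case True
    have "w1 = 0"
    proof (rule ccontr)
      assume "w1 \<noteq> 0"
      then show False using assms[of "(1 - w0) / w1"] True by simp
    qed
    then show ?thesis using True by simp
  next
    case False
    then have "w2 < 0" using w2 by simp
    have "w0 + w1 * (- w1 / (2 * w2)) + w2 * (- w1 / (2 * w2))\<^sup>2 \<le> 0" by (rule assms)
    also have "w0 + w1 * (- w1 / (2 * w2)) + w2 * (- w1 / (2 * w2))\<^sup>2 = (4 * w0 * w2 - w1\<^sup>2) / (4 * w2)"
      using False by (simp add: field_simps power2_eq_square)
    finally show ?thesis using \<open>w2 < 0\<close> by (simp add: divide_le_0_iff)
  qed
qed

text \<open>Convexity of \<open>q / p\<close> at the chord from \<open>0\<close> to \<open>t\<close>, cleared of denominators;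
  \<open>w0 + w1 s + w2 s\<^sup>2\<close> is the Wronskian \<open>q' p - q p'\<close>.\<close>

lemma quotient_convex:
  fixes p0 p1 p2 q0 q1 q2 t :: real
  defines "w0 \<equiv> q1 * p0 - q0 * p1" and "w1 \<equiv> 2 * (q2 * p0 - q0 * p2)" and "w2 \<equiv> q2 * p1 - q1 * p2"
  assumes p: "p0 > 0" "p1 \<ge> 0" "p2 \<ge> 0" and t: "t \<ge> 0"
    and W: "\<And>s. w0 + w1 * s + w2 * s\<^sup>2 \<le> 0"
  shows "(w0 + w1 * t / 2) * (p0 + p1 * t + p2 * t\<^sup>2) \<le> p0 * (w0 + w1 * t + w2 * t\<^sup>2)"
proof -
  note d = nonpos_quadratic_discrim[OF W]
  \<comment> \<open>Expansion of the vanishing 3 x 3 determinant whose rows are the coefficients of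
    \<open>p\<close>, \<open>p\<close> and \<open>q\<close>.\<close>
  have id: "w1 * p1 / 2 = w0 * p2 + w2 * p0"
    by (simp add: w0_def w1_def w2_def field_simps)
  have w02: "w0 * p2 \<le> 0" "w2 * p0 \<le> 0" using d p by (auto simp: mult_nonpos_nonneg)
  have w1: "w1 \<le> 0"
  proof (cases "p1 = 0")
    case True
    then have "w0 * p2 + w2 * p0 = 0" using id by simp
    then have "w2 * p0 = 0" using w02 by linarith
    then have "w2 = 0" using p(1) by simp
    then have "w1\<^sup>2 \<le> 0" using d(3) by simp
    then show ?thesis by simp
  next
    case False
    then have "w1 * p1 \<le> 0" "p1 > 0" using id w02 p by auto
    then show ?thesis by (simp add: mult_le_0_iff)
  qed
  \<comment> \<open>If \<open>w1 < 0\<close>, multiplication by \<open>w1\<close> reduces this to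
    the discriminant bound together with \<open>w2 * p0 \<ge> w1 * p1 / 2\<close>, which follows
    from \<open>id\<close>.\<close>
  have key: "w1 * p0 / 2 - w0 * p1 \<ge> 0"
  proof (cases "w1 = 0")
    case True
    then show ?thesis using d p by (simp add: mult_nonpos_nonneg)
  next
    case False
    then have w1: "w1 < 0" using w1 by simp
    have "w1\<^sup>2 * p0 \<le> 4 * w0 * w2 * p0" using d(3) p by (intro mult_right_mono) auto
    also have "\<dots> = 4 * w0 * (w2 * p0)" by simp
    also have "\<dots> \<le> 4 * w0 * (w1 * p1 / 2)"
    proof (rule mult_left_mono_neg)
      show "w1 * p1 / 2 \<le> w2 * p0" unfolding id using w02 by linarith
    qed (use d(1) in simp)
    finally have "w1\<^sup>2 * p0 - 2 * (w0 * w1 * p1) \<le> 0" by (simp add: mult.commute mult.left_commute)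
    moreover have "w1 * (w1 * p0 / 2 - w0 * p1) = (w1\<^sup>2 * p0 - 2 * (w0 * w1 * p1)) / 2"
      by (simp add: algebra_simps power2_eq_square diff_divide_distrib)
    ultimately have "w1 * (w1 * p0 / 2 - w0 * p1) \<le> 0" by simp
    then show ?thesis using w1 by (simp add: mult_le_0_iff)
  qed
  have "w1 * p2 \<le> 0" using w1 p(3) by (rule mult_nonpos_nonneg)
  then have "0 \<le> - (w1 * p2 / 2)" by simp
  then have r2: "0 \<le> t\<^sup>2 * (- (w1 * p2 / 2))" by (rule mult_nonneg_nonneg[OF zero_le_power2])
  have "0 \<le> 2 * (- (w0 * p2))" using w02(1) by linarith
  then have r1: "0 \<le> t * (2 * (- (w0 * p2)))" by (rule mult_nonneg_nonneg[OF t])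
  have rest: "0 \<le> t * ((w1 * p0 / 2 - w0 * p1) + t * (2 * (- (w0 * p2))) + t\<^sup>2 * (- (w1 * p2 / 2)))"
    by (rule mult_nonneg_nonneg[OF t add_nonneg_nonneg[OF add_nonneg_nonneg[OF key r1] r2]])
  \<comment> \<open>Rewriting the middle coefficient by \<open>id\<close> makes every coefficient in
    the bracket nonnegative.\<close>
  have "p0 * (w0 + w1 * t + w2 * t\<^sup>2) - (w0 + w1 * t / 2) * (p0 + p1 * t + p2 * t\<^sup>2)
     = t * ((w1 * p0 / 2 - w0 * p1) + t * (w2 * p0 - w0 * p2 - w1 * p1 / 2) + t\<^sup>2 * (- (w1 * p2 / 2)))"
    by (simp add: algebra_simps power2_eq_square)
  also have "w2 * p0 - w0 * p2 - w1 * p1 / 2 = 2 * (- (w0 * p2))" unfolding id by simp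
  finally have "0 \<le> p0 * (w0 + w1 * t + w2 * t\<^sup>2) - (w0 + w1 * t / 2) * (p0 + p1 * t + p2 * t\<^sup>2)"
    using rest by (simp only:)
  then show ?thesis by (rule iffD1[OF diff_ge_0_iff_ge])
qed

text \<open>The barrier step on a line. Replacing \<open>q / p\<close> by
  \<open>(q - q') / (p - p')\<close> adds \<open>- V \<delta> / (p * (p - p'))\<close>, and
  \<open>le\<close> gives \<open>p - p' \<ge> p / \<delta>\<close>. So the increase is at most
  \<open>- \<delta>\<close> times the slope of \<open>q / p\<close> at \<open>\<delta>\<close>,
  which convexity bounds by the drop of \<open>q / p\<close> from 0 to
  \<open>\<delta>\<close>.\<close>

lemma quotient_shift_le:
  fixes p0 p1 p2 q0 q1 q2 \<delta> :: real
  defines "p \<equiv> p0 + p1 * \<delta> + p2 * \<delta>\<^sup>2" and "q \<equiv> q0 + q1 * \<delta> + q2 * \<delta>\<^sup>2"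
    and "p' \<equiv> p1 + 2 * p2 * \<delta>" and "q' \<equiv> q1 + 2 * q2 * \<delta>"
  assumes p: "p0 > 0" "p1 \<ge> 0" "p2 \<ge> 0" and \<delta>: "\<delta> > 0"
    and W: "\<And>s. (q1 + 2 * q2 * s) * (p0 + p1 * s + p2 * s\<^sup>2) - (q0 + q1 * s + q2 * s\<^sup>2) * (p1 + 2 * p2 * s) \<le> 0"
    and le: "p' / p \<le> 1 - 1 / \<delta>"
  shows "(q - q') / (p - p') \<le> q0 / p0"
proof -
  define w0 where "w0 = q1 * p0 - q0 * p1"
  define w1 where "w1 = 2 * (q2 * p0 - q0 * p2)"
  define w2 where "w2 = q2 * p1 - q1 * p2"
  define V where "V s = w0 + w1 * s + w2 * s\<^sup>2" for s
  have V: "V s = (q1 + 2 * q2 * s) * (p0 + p1 * s + p2 * s\<^sup>2) - (q0 + q1 * s + q2 * s\<^sup>2) * (p1 + 2 * p2 * s)" for s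
    by (simp add: V_def w0_def w1_def w2_def algebra_simps power2_eq_square)
  have V\<delta>: "V \<delta> = q' * p - q * p'" by (simp add: V p_def q_def p'_def q'_def)
  have Vn: "V s \<le> 0" for s using W by (simp add: V)
  have conv: "(w0 + w1 * \<delta> / 2) * p \<le> p0 * V \<delta>"
    unfolding V_def p_def w0_def w1_def w2_def
    using p \<delta> Vn by (intro quotient_convex) (auto simp: V_def w0_def w1_def w2_def)
  have pp: "p > 0" using p \<delta> unfolding p_def by (intro add_pos_nonneg) auto
  have "p' \<le> (1 - 1 / \<delta>) * p" using le pp by (simp add: pos_divide_le_eq)
  then have pd: "p - p' \<ge> p / \<delta>" by (simp add: algebra_simps)
  then have ppos: "p - p' > 0" using pp \<delta> by (smt (verit) divide_pos_pos)
  have "(q - q') / (p - p') - q / p = - V \<delta> / (p * (p - p'))"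
    using pp ppos by (simp add: V\<delta> field_simps)
  also have "\<dots> \<le> - V \<delta> / (p * (p / \<delta>))"
    using pd pp ppos \<delta> Vn[of \<delta>] by (intro divide_left_mono mult_left_mono mult_pos_pos) auto
  also have "\<dots> = - \<delta> * (p0 * V \<delta>) / (p0 * p * p)" using pp p \<delta> by (simp add: field_simps)
  also have "\<dots> \<le> - \<delta> * ((w0 + w1 * \<delta> / 2) * p) / (p0 * p * p)"
    using conv pp p \<delta> by (intro divide_right_mono) (auto intro: mult_left_mono)
  also have "\<dots> = - \<delta> * (w0 + w1 * \<delta> / 2) / (p0 * p)" using pp p by (simp add: field_simps)
  also have "\<dots> = q0 / p0 - q / p"
  proof -
    have "\<delta> * (w0 + w1 * \<delta> / 2) = q * p0 - q0 * p"
      by (simp add: w0_def w1_def p_def q_def field_simps power2_eq_square)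
    then have "- \<delta> * (w0 + w1 * \<delta> / 2) = q0 * p - q * p0" by simp
    then show ?thesis using pp p by (simp only:) (simp add: field_simps)
  qed
  finally show ?thesis by simp
qed

lemma multiaffine_upd2:
  assumes "multiaffine p" "a \<noteq> b"
  shows "p (y(a := y a + s, b := y b + t)) 
    = p y + s * pdiff a p y + t * pdiff b p y + s * t * pdiff a (pdiff b p) y"
proof -
  have "p (y(a := y a + s, b := y b + t)) = p (y(a := y a + s, b := (y(a := y a + s)) b + t))"
    using assms(2) by simp
  also have "\<dots> = p (y(a := y a + s)) + t * pdiff b p (y(a := y a + s))"
    by (rule multiaffineD[OF assms(1)])
  also have "\<dots> = p y + s * pdiff a p y + t * (pdiff b p y + s * pdiff a (pdiff b p) y)"
    by (simp only: multiaffineD[OF assms(1)] multiaffineD[OF multiaffine_pdiff[OF assms(1)]])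
  finally show ?thesis by (simp add: algebra_simps)
qed

lemma pdiff_upd2:
  assumes "multiaffine p" "a \<noteq> b"
  shows "pdiff a p (y(a := y a + s, b := y b + t)) = pdiff a p y + t * pdiff a (pdiff b p) y"
    "pdiff b p (y(a := y a + s, b := y b + t)) = pdiff b p y + s * pdiff a (pdiff b p) y"
proof -
  have "y(a := y a + s, b := y b + t) = (y(b := y b + t))(a := y a + s)"
    using assms(2) by (simp add: fun_upd_twist)
  then show "pdiff a p (y(a := y a + s, b := y b + t)) = pdiff a p y + t * pdiff a (pdiff b p) y"
    using pdiff_upd_same[OF assms(1), of a "y(b := y b + t)"]
      multiaffineD[OF multiaffine_pdiff[OF assms(1)], of a y b t] 
    by (simp add: pdiff_commute[of a b])
  show "pdiff b p (y(a := y a + s, b := y b + t)) = pdiff b p y + s * pdiff a (pdiff b p) y"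
    using pdiff_upd_same[OF assms(1), of b "y(a := y a + s)"]
      multiaffineD[OF multiaffine_pdiff[OF assms(1)], of b y a s] by simp
qed

text \<open>Moving both variables up by \<open>\<delta>\<close> pays for the operator. Positivity
  persists because the barriers for \<open>a\<close> and \<open>b\<close> sum to less than 1 above
  \<open>y'\<close>; the barrier bound is \<open>quotient_shift_le\<close> on the diagonal of the
  \<open>a\<close>-\<open>b\<close> plane.\<close>

lemma barrier_step:
  assumes p: "multiaffine p" "rayleigh p" "above p y" and ab: "a \<noteq> b" and \<delta>: "\<delta> > 0"
    and le: "barrier a p y + barrier b p y \<le> 1 - 1 / \<delta>"
  defines "y' \<equiv> y(a := y a + \<delta>, b := y b + \<delta>)"
  shows "above (diff_op a b 1 1 p) y'"
    "barrier e (diff_op a b 1 1 p) y' \<le> barrier e p y"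
proof -
  have y': "above p y'" 
    using above_upd[OF above_upd[OF p(3), of \<delta> a], of \<delta> b] ab \<delta> by (simp add: y'_def)
  have le': "barrier a p y' + barrier b p y' \<le> 1 - 1 / \<delta>"
  proof -
    have "barrier x p y' \<le> barrier x p y" for x
    proof -
      have "barrier x p y' \<le> barrier x p (y(a := y a + \<delta>))"
        using barrier_upd_le[OF p(1,2) above_upd[OF p(3), of \<delta> a], where s = \<delta> and a = x and e = b] ab \<delta> by (simp add: y'_def)
      also have "\<dots> \<le> barrier x p y"
        using barrier_upd_le[OF p, where s = \<delta> and a = x and e = a] \<delta> by simp
      finally show ?thesis .
    qed
    from this[of a] this[of b] le show ?thesis by linarith
  qed
  show "above (diff_op a b 1 1 p) y'"
    unfolding above_def
  proof (intro allI impI)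
    fix w :: "'a \<Rightarrow> real" assume w: "finite {e. w e \<noteq> 0}" "\<forall>e. w e \<ge> 0"
    let ?z = "\<lambda>e. y' e + w e"
    have pz: "p ?z > 0" using y' w unfolding above_def by blast
    have "barrier a p ?z + barrier b p ?z \<le> 1 - 1 / \<delta>"
      using barrier_mono[OF p(1,2) y' w(1), of a] barrier_mono[OF p(1,2) y' w(1), of b] w(2) le' by auto
    also have "\<dots> < 1" using \<delta> by simp
    finally have "pdiff a p ?z + pdiff b p ?z < p ?z"
      using pz by (simp add: barrier_def flip: add_divide_distrib)
    then show "diff_op a b 1 1 p ?z > 0" by (simp add: diff_op_def)
  qed
  show "barrier e (diff_op a b 1 1 p) y' \<le> barrier e p y"
  proof -
    let ?q = "pdiff e p"
    have q: "multiaffine ?q" by (rule multiaffine_pdiff[OF p(1)])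
    let ?p1 = "pdiff a p y + pdiff b p y" and ?p2 = "pdiff a (pdiff b p) y"
    let ?q1 = "pdiff a ?q y + pdiff b ?q y" and ?q2 = "pdiff a (pdiff b ?q) y"
    \<comment> \<open>On this diagonal \<open>p\<close> and \<open>?q\<close> are quadratic in
      \<open>t\<close>, and adding the inequalities \<open>ray\<close> for \<open>a\<close> and
      \<open>b\<close> gives the sign of their Wronskian.\<close>
    define Y where "Y t = y(a := y a + t, b := y b + t)" for t
    have pY: "p (Y t) = p y + ?p1 * t + ?p2 * t\<^sup>2" for t
      unfolding Y_def multiaffine_upd2[OF p(1) ab] by (simp add: algebra_simps power2_eq_square)
    have qY: "?q (Y t) = ?q y + ?q1 * t + ?q2 * t\<^sup>2" for t
      unfolding Y_def multiaffine_upd2[OF q ab] by (simp add: algebra_simps power2_eq_square)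
    have dpY: "pdiff a p (Y t) + pdiff b p (Y t) = ?p1 + 2 * ?p2 * t" for t
      unfolding Y_def pdiff_upd2[OF p(1) ab] by (simp add: algebra_simps)
    have dqY: "pdiff a ?q (Y t) + pdiff b ?q (Y t) = ?q1 + 2 * ?q2 * t" for t
      unfolding Y_def pdiff_upd2[OF q ab] by (simp add: algebra_simps)
    have ray: "p z * pdiff c ?q z \<le> pdiff c p z * ?q z" for c z
    proof (cases "c = e")
      case True
      have "pdiff e ?q z = 0"
        by (simp add: pdiff_def[of e "pdiff e p"] pdiff_upd_same[OF p(1)])
      then show ?thesis using True by simp
    next
      case False
      then show ?thesis using p(2) unfolding rayleigh_def by blast
    qed
    have "(?q (Y \<delta>) - (?q1 + 2 * ?q2 * \<delta>)) / (p (Y \<delta>) - (?p1 + 2 * ?p2 * \<delta>)) \<le> ?q y / p y"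
      unfolding pY qY
    proof (rule quotient_shift_le)
      show "p y > 0" by (rule above_pos[OF p(3)])
      show "?p1 \<ge> 0" "?p2 \<ge> 0" using pdiff_nonneg[OF p(1,3)] pdiff2_nonneg[OF p(1,3)] by auto
      show "(?q1 + 2 * ?q2 * s) * (p y + ?p1 * s + ?p2 * s\<^sup>2) - (?q y + ?q1 * s + ?q2 * s\<^sup>2) * (?p1 + 2 * ?p2 * s) \<le> 0" for s
        using ray[of "Y s" a] ray[of "Y s" b]
        unfolding pY[symmetric] qY[symmetric] dpY[symmetric] dqY[symmetric]
        by (simp add: algebra_simps)
      show "(?p1 + 2 * ?p2 * \<delta>) / (p y + ?p1 * \<delta> + ?p2 * \<delta>\<^sup>2) \<le> 1 - 1 / \<delta>"
        using le' unfolding pY[symmetric] dpY[symmetric]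
        by (simp add: barrier_def add_divide_distrib y'_def Y_def)
    qed (rule \<delta>)
    \<comment> \<open>Derivatives commute with the operator, so the new barrier is the quotient
      bounded above.\<close>
    moreover have "pdiff e (diff_op a b 1 1 p) y' = diff_op a b 1 1 ?q y'"
      by (simp add: diff_op_def pdiff_def[of e "diff_op a b 1 1 p"] pdiff_commute[of _ e] pdiff_def[of e])
    moreover have "y' = Y \<delta>" by (simp add: y'_def Y_def)
    ultimately show ?thesis
      unfolding dpY[symmetric] dqY[symmetric] barrier_def
      by (simp add: diff_op_def diff_diff_add)
  qed
qed

text \<open>No barrier increases in a step, so the bound for the remaining indices survives the
  induction.\<close>

lemma mixed_above:
  assumes P: "stable_poly n L P" and js: "distinct js" and \<delta>: "\<delta> > 0"
    and y: "above (real_version P) y"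
    and le: "\<And>j. j \<in> set js \<Longrightarrow>
      barrier (j, True) (real_version P) y + barrier (j, False) (real_version P) y \<le> 1 - 1 / \<delta>"
  shows "above (real_version (mixed js P)) (\<lambda>e. if fst e \<in> set js then y e + \<delta> else y e)"
  using P js y le
proof (induction js arbitrary: P y)
  case (Cons j js)
  let ?P = "diff_op (j, True) (j, False) 1 1 P"
  let ?y = "y((j, True) := y (j, True) + \<delta>, (j, False) := y (j, False) + \<delta>)"
  note P = Cons.prems(1)
  have step: "above (real_version ?P) ?y" "barrier e (real_version ?P) ?y \<le> barrier e (real_version P) y" for e
    unfolding real_version_diff_op
    using Cons.prems(3) \<delta> Cons.prems(4)[of j]
    by (intro barrier_step multiaffine_real_version[OF stable_polyD(1)[OF P]] rayleigh_real_version[OF P]; simp)+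
  have "above (real_version (mixed js ?P)) (\<lambda>e. if fst e \<in> set js then ?y e + \<delta> else ?y e)"
  proof (rule Cons.IH)
    show "stable_poly n L ?P" using stable_poly_diff_op[OF P, of 1 1] by simp
    show "distinct js" using Cons.prems by simp
    show "above (real_version ?P) ?y" by (rule step)
    fix k assume "k \<in> set js"
    then show "barrier (k, True) (real_version ?P) ?y + barrier (k, False) (real_version ?P) ?y \<le> 1 - 1 / \<delta>"
      using Cons.prems(4)[of k] step(2)[of "(k, True)"] step(2)[of "(k, False)"] by auto
  qed
  also have "(\<lambda>e. if fst e \<in> set js then ?y e + \<delta> else ?y e)
      = (\<lambda>e. if fst e \<in> set (j # js) then y e + \<delta> else y e)"
    using Cons.prems(2) by (auto simp: fun_eq_iff)
  finally show ?case by simp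
qed simp

subsection \<open>Determinants of weighted Gram matrices\<close>

text \<open>The cofactors along row \<open>k\<close> do not involve that row.\<close>

lemma det_row_affine:
  fixes a b :: "nat \<Rightarrow> 'a::comm_ring_1" and m :: "nat \<Rightarrow> nat \<Rightarrow> 'a" and k n :: nat
  assumes k: "k < n"
  defines "d s \<equiv> det (mat n n (\<lambda>(r, c). if r = k then a c + s * b c else m r c))"
  shows "d s = d 0 + s * (d 1 - d 0)"
proof -
  define M where "M f = mat n n (\<lambda>(r, c). if r = k then f c else m r c)" for f
  have M: "M f \<in> carrier_mat n n" for f by (simp add: M_def)
  have "mat_delete (M f) k c = mat_delete (M a) k c" for f c
    by (rule eq_matI) (auto simp: M_def mat_delete_def)
  then have cof: "cofactor (M f) k c = cofactor (M a) k c" for f c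
    unfolding cofactor_def by (metis (no_types))
  have "det (M f) = (\<Sum>c<n. f c * cofactor (M a) k c)" for f
    unfolding laplace_expansion_row[OF M k] cof[of f] using k by (simp add: M_def)
  then have "d s = (\<Sum>c<n. (a c + s * b c) * cofactor (M a) k c)" for s
    unfolding d_def M_def by metis
  then show ?thesis by (simp add: algebra_simps sum.distrib sum_distrib_left sum_subtractf)
qed

text \<open>Row operations with a pivot row \<open>k\<close> clear the rank-one term from all other
  rows, which leaves \<open>s\<close> in a single row.\<close>

lemma det_rank_one_affine:
  fixes A :: "'a::field mat" and u w :: "nat \<Rightarrow> 'a" and n :: nat
  defines "d s \<equiv> det (mat n n (\<lambda>(r, c). A $$ (r, c) + s * (u r * w c)))"
  shows "d s = d 0 + s * (d 1 - d 0)"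
proof (cases "\<exists>k<n. u k \<noteq> 0")
  case False
  then have "mat n n (\<lambda>(r, c). A $$ (r, c) + s * (u r * w c)) = mat n n (\<lambda>(r, c). A $$ (r, c))" for s
    by (intro eq_matI) auto
  from this[of s] this[of 1] this[of 0] show ?thesis unfolding d_def by simp
next
  case True
  then obtain k where k: "k < n" "u k \<noteq> 0" by blast
  \<comment> \<open>Adds \<open>\<kappa> r\<close> times row \<open>k\<close> to each other row
    \<open>r\<close>; \<open>U \<kappa>\<close> is the matrix of this operation, inverted by
    changing the sign of \<open>\<kappa>\<close>.\<close>
  define T where "T \<kappa> M = mat n n (\<lambda>(r, c). if r = k then M $$ (k, c) else M $$ (r, c) + \<kappa> r * M $$ (k, c))"
    for \<kappa> :: "nat \<Rightarrow> 'a" and M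
  define U where "U \<kappa> = T \<kappa> (1\<^sub>m n)" for \<kappa>
  have Uc: "U \<kappa> \<in> carrier_mat n n" for \<kappa> by (simp add: U_def T_def)
  have UM: "U \<kappa> * M = T \<kappa> M" if M: "M \<in> carrier_mat n n" for \<kappa> M
  proof (rule eq_matI)
    show "dim_row (U \<kappa> * M) = dim_row (T \<kappa> M)" "dim_col (U \<kappa> * M) = dim_col (T \<kappa> M)"
      using M Uc[of \<kappa>] by (simp_all add: T_def)
    fix i j assume "i < dim_row (T \<kappa> M)" "j < dim_col (T \<kappa> M)"
    then have ij: "i < n" "j < n" by (auto simp: T_def)
    have "(U \<kappa> * M) $$ (i, j) = (\<Sum>l = 0..<n. U \<kappa> $$ (i, l) * M $$ (l, j))"
      using ij M Uc[of \<kappa>] by (auto simp: scalar_prod_def)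
    also have "\<dots> = (\<Sum>l = 0..<n. (if l = i then M $$ (l, j) else 0) 
        + (if l = k then (if i = k then 0 else \<kappa> i) * M $$ (l, j) else 0))"
      using ij k by (intro sum.cong) (auto simp: U_def T_def)
    also have "\<dots> = T \<kappa> M $$ (i, j)"
      using ij k by (simp add: sum.distrib T_def)
    finally show "(U \<kappa> * M) $$ (i, j) = T \<kappa> M $$ (i, j)" .
  qed
  have "U (\<lambda>r. - \<kappa> r) * U \<kappa> = 1\<^sub>m n" for \<kappa>
    unfolding UM[OF Uc] using k by (intro eq_matI) (auto simp: T_def U_def)
  then have "det (U (\<lambda>r. - \<kappa> r)) * det (U \<kappa>) = 1" for \<kappa>
    by (simp flip: det_mult[OF Uc Uc])
  then have dU: "det (U \<kappa>) \<noteq> 0" for \<kappa> by (metis mult_zero_right zero_neq_one)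
  \<comment> \<open>Chosen so that \<open>\<kappa> r * u k\<close> cancels
    \<open>u r\<close>.\<close>
  define \<kappa> where "\<kappa> r = - u r / u k" for r
  define B where "B s = mat n n (\<lambda>(r, c). A $$ (r, c) + s * (u r * w c))" for s
  have B: "B s \<in> carrier_mat n n" for s by (simp add: B_def)
  have "U \<kappa> * B s = mat n n (\<lambda>(r, c). if r = k then A $$ (k, c) + s * (u k * w c) 
      else A $$ (r, c) + \<kappa> r * A $$ (k, c))" for s
    unfolding UM[OF B] using k by (intro eq_matI) (auto simp: T_def B_def \<kappa>_def field_simps)
  then have "det (U \<kappa>) * det (B s) = det (mat n n (\<lambda>(r, c). if r = k then A $$ (k, c) + s * (u k * w c) 
      else A $$ (r, c) + \<kappa> r * A $$ (k, c)))" for s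
    by (simp flip: det_mult[OF Uc B])
  then have "det (U \<kappa>) * det (B s) = det (U \<kappa>) * det (B 0) + s * (det (U \<kappa>) * det (B 1) - det (U \<kappa>) * det (B 0))"
    using det_row_affine[OF k(1), of "\<lambda>c. A $$ (k, c)" s "\<lambda>c. u k * w c" "\<lambda>r c. A $$ (r, c) + \<kappa> r * A $$ (k, c)"]
    by (simp only:)
  then have "det (U \<kappa>) * det (B s) = det (U \<kappa>) * (det (B 0) + s * (det (B 1) - det (B 0)))"
    by (simp add: algebra_simps)
  then have "det (B s) = det (B 0) + s * (det (B 1) - det (B 0))"
    using dU by simp
  then show ?thesis by (simp add: B_def d_def)
qed

lemma coeff_prod_linear:
  assumes "finite S" "\<And>i. i \<in> S \<Longrightarrow> degree (g i) \<le> 1"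
  shows "degree (\<Prod>i\<in>S. g i) \<le> card S \<and> coeff (\<Prod>i\<in>S. g i) (card S) = (\<Prod>i\<in>S. coeff (g i :: 'a::comm_ring_1 poly) 1)"
  using assms
proof (induction S)
  case (insert i S)
  let ?q = "\<Prod>i\<in>S. g i"
  have IH: "degree ?q \<le> card S" "coeff ?q (card S) = (\<Prod>i\<in>S. coeff (g i) 1)" 
    and gi: "degree (g i) \<le> 1" using insert by auto
  have "degree (g i * ?q) \<le> Suc (card S)"
    using degree_mult_le[of "g i" ?q] IH gi by linarith
  moreover have "coeff (g i * ?q) (1 + card S) = coeff (g i) 1 * coeff ?q (card S)"
  proof -
    have "coeff (g i * ?q) (1 + card S) = (\<Sum>l\<le>1 + card S. coeff (g i) l * coeff ?q (1 + card S - l))"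
      by (rule coeff_mult)
    also have "\<dots> = (\<Sum>l\<in>{1}. coeff (g i) l * coeff ?q (1 + card S - l))"
    proof (rule sum.mono_neutral_right)
      show "\<forall>l\<in>{..1 + card S} - {1}. coeff (g i) l * coeff ?q (1 + card S - l) = 0"
      proof
        fix l assume "l \<in> {..1 + card S} - {1}"
        then consider "l = 0" | "l > 1" by force
        then show "coeff (g i) l * coeff ?q (1 + card S - l) = 0"
          using IH(1) gi by cases (auto simp: coeff_eq_0)
      qed
    qed auto
    finally show ?thesis by simp
  qed
  ultimately show ?case using insert IH by simp
qed simp

text \<open>The determinant is taken over polynomials: each Leibniz term is a product of
  \<open>n\<close> factors of degree at most 1, and evaluation at \<open>x\<close> is a ring
  homomorphism.\<close>

lemma det_linear_pencil:
  fixes A B :: "nat \<Rightarrow> nat \<Rightarrow> 'a::idom"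
  shows "\<exists>f. degree f \<le> n \<and> coeff f n = det (mat n n (\<lambda>(r, c). B r c)) \<and>
    (\<forall>x. det (mat n n (\<lambda>(r, c). A r c + x * B r c)) = poly f x)"
proof -
  define M where "M = mat n n (\<lambda>(r, c). [:A r c, B r c:])"
  have M: "M \<in> carrier_mat n n" by (simp add: M_def)
  have deg: "degree (\<Prod>i = 0..<n. M $$ (i, p i)) \<le> n \<and> 
      coeff (\<Prod>i = 0..<n. M $$ (i, p i)) n = (\<Prod>i = 0..<n. B i (p i))"
    if p: "p permutes {0..<n}" for p
  proof -
    have pi: "p i < n" if "i < n" for i using permutes_in_image[OF p, of i] that by simp
    have "degree (M $$ (i, p i)) \<le> 1" if "i \<in> {0..<n}" for i
      using that pi by (simp add: M_def)
    moreover have "(\<Prod>i = 0..<n. coeff (M $$ (i, p i)) 1) = (\<Prod>i = 0..<n. B i (p i))"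
      using pi by (intro prod.cong) (auto simp: M_def)
    ultimately show ?thesis using coeff_prod_linear[of "{0..<n}" "\<lambda>i. M $$ (i, p i)"] by simp
  qed
  have sgc: "coeff (signof p * q) m = signof p * coeff q m" for p :: "nat \<Rightarrow> nat" and q :: "'a poly" and m
    by (simp add: sign_def)
  have "degree (det M) \<le> n"
    unfolding det_def'[OF M]
  proof (intro degree_sum_le)
    show "finite {p. p permutes {0..<n}}" by (simp add: finite_permutations)
    fix p assume "p \<in> {p. p permutes {0..<n}}"
    then show "degree (signof p * (\<Prod>i = 0..<n. M $$ (i, p i))) \<le> n"
      using deg by (auto simp: sign_def)
  qed
  moreover have "coeff (det M) n = det (mat n n (\<lambda>(r, c). B r c))"
  proof -
    have "coeff (det M) n = (\<Sum>p\<in>{p. p permutes {0..<n}}. signof p * (\<Prod>i = 0..<n. B i (p i)))"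
      unfolding det_def'[OF M] coeff_sum sgc using deg by (intro sum.cong) auto
    also have "\<dots> = det (mat n n (\<lambda>(r, c). B r c))"
    proof (subst det_def'[of _ n])
      have "(\<Prod>i = 0..<n. B i (p i)) = (\<Prod>i = 0..<n. mat n n (\<lambda>(r, c). B r c) $$ (i, p i))"
        if p: "p permutes {0..<n}" for p
      proof (intro prod.cong)
        fix i assume "i \<in> {0..<n}"
        then show "B i (p i) = mat n n (\<lambda>(r, c). B r c) $$ (i, p i)"
          using permutes_in_image[OF p, of i] by simp
      qed simp
      then show "(\<Sum>p\<in>{p. p permutes {0..<n}}. signof p * (\<Prod>i = 0..<n. B i (p i)))
        = (\<Sum>p\<in>{p. p permutes {0..<n}}. signof p * (\<Prod>i = 0..<n. mat n n (\<lambda>(r, c). B r c) $$ (i, p i)))"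
        by (intro sum.cong) auto
    qed simp
    finally show ?thesis .
  qed
  moreover have "det (mat n n (\<lambda>(r, c). A r c + x * B r c)) = poly (det M) x" for x
  proof -
    interpret comm_ring_hom "\<lambda>p. poly p x" by unfold_locales auto
    have "mat n n (\<lambda>(r, c). A r c + x * B r c) = map_mat (\<lambda>p. poly p x) M"
      by (intro eq_matI) (auto simp: M_def)
    then show ?thesis by (simp only: hom_det)
  qed
  ultimately show ?thesis by blast
qed

section \<open>Euclidean norm and the Cauchy-Schwarz inequality\<close>

lemma euclid_norm_sq:
  assumes "w \<in> carrier_vec N"
  shows "(euclid_norm w)\<^sup>2 = (\<Sum>i<N. (cmod (w $ i))\<^sup>2)"
  using assms by (simp add: euclid_norm_def L2_set_def sum_nonneg lessThan_atLeast0)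

lemma euclid_norm_sq_pos:
  assumes "w \<in> carrier_vec N" "w \<noteq> 0\<^sub>v N"
  shows "(euclid_norm w)\<^sup>2 > 0"
proof -
  obtain i where i: "i < N" "w $ i \<noteq> 0"
    using assms by (metis carrier_vecD eq_vecI index_zero_vec)
  have "(\<Sum>i<N. (cmod (w $ i))\<^sup>2) > 0"
    using i by (intro sum_pos2[of _ i]) auto
  then show ?thesis by (simp add: euclid_norm_sq[OF assms(1)])
qed

lemma cscalar_prod_sum:
  assumes "v \<in> carrier_vec N"
  shows "w \<bullet>c v = (\<Sum>i<N. w $ i * cnj (v $ i))"
  using assms by (simp add: scalar_prod_def lessThan_atLeast0)

lemma cscalar_prod_Cauchy_Schwarz:
  assumes "v \<in> carrier_vec N" "w \<in> carrier_vec N"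
  shows "(cmod (w \<bullet>c v))\<^sup>2 \<le> (euclid_norm v)\<^sup>2 * (euclid_norm w)\<^sup>2"
proof -
  have "cmod (w \<bullet>c v) \<le> (\<Sum>i<N. cmod (w $ i) * cmod (v $ i))"
    unfolding cscalar_prod_sum[OF assms(1)]
    by (rule order.trans[OF norm_sum]) (simp add: norm_mult)
  also have "\<dots> \<le> L2_set (\<lambda>i. cmod (w $ i)) {..<N} * L2_set (\<lambda>i. cmod (v $ i)) {..<N}"
    using L2_set_mult_ineq[of "\<lambda>i. cmod (w $ i)" "\<lambda>i. cmod (v $ i)" "{..<N}"] by simp
  also have "\<dots> = euclid_norm w * euclid_norm v"
    using assms by (simp add: euclid_norm_def lessThan_atLeast0)
  finally show ?thesis
    by (metis mult.commute norm_ge_zero power_mono power_mult_distrib)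
qed

section \<open>Gram determinants with complex weights\<close>

locale vector_system =
  fixes N :: nat and J :: "'a set" and v :: "'a \<Rightarrow> complex vec"
  assumes finite_J: "finite J" and v_carrier: "j \<in> J \<Longrightarrow> v j \<in> carrier_vec N"
begin

definition gram :: "('a \<Rightarrow> complex) \<Rightarrow> complex mat" where
  "gram y = mat N N (\<lambda>(r, c). \<Sum>j\<in>J. y j * (v j $ r * cnj (v j $ c)))"

definition gdet :: "('a \<Rightarrow> complex) \<Rightarrow> complex" where
  "gdet y = det (gram y)"

lemma gram_carrier: "gram y \<in> carrier_mat N N"
  by (simp add: gram_def)

lemma gdet_cong: "(\<And>j. j \<in> J \<Longrightarrow> y j = z j) \<Longrightarrow> gdet y = gdet z"
  unfolding gdet_def gram_def by (simp cong: sum.cong)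

lemma gram_mult_vec:
  assumes "w \<in> carrier_vec N" "i < N"
  shows "(gram y *\<^sub>v w) $ i = (\<Sum>j\<in>J. y j * (w \<bullet>c v j) * v j $ i)"
proof -
  have "(gram y *\<^sub>v w) $ i = (\<Sum>c<N. (\<Sum>j\<in>J. y j * (v j $ i * cnj (v j $ c))) * w $ c)"
    using assms by (simp add: gram_def scalar_prod_def lessThan_atLeast0)
  also have "\<dots> = (\<Sum>j\<in>J. \<Sum>c<N. y j * (v j $ i * cnj (v j $ c)) * w $ c)"
    by (simp add: sum_distrib_right) (rule sum.swap)
  also have "\<dots> = (\<Sum>j\<in>J. y j * (w \<bullet>c v j) * v j $ i)"
    by (intro sum.cong refl)
       (simp add: cscalar_prod_sum[OF v_carrier] sum_distrib_left sum_distrib_right algebra_simps)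
  finally show ?thesis .
qed

lemma gram_form:
  assumes "w \<in> carrier_vec N" "x \<in> carrier_vec N"
  shows "(\<Sum>i<N. (gram y *\<^sub>v w) $ i * cnj (x $ i)) = (\<Sum>j\<in>J. y j * (w \<bullet>c v j) * cnj (x \<bullet>c v j))"
proof -
  have "(\<Sum>i<N. (gram y *\<^sub>v w) $ i * cnj (x $ i))
      = (\<Sum>i<N. \<Sum>j\<in>J. y j * (w \<bullet>c v j) * v j $ i * cnj (x $ i))"
    by (simp add: gram_mult_vec[OF assms(1)] sum_distrib_right)
  also have "\<dots> = (\<Sum>j\<in>J. \<Sum>i<N. y j * (w \<bullet>c v j) * v j $ i * cnj (x $ i))"
    by (rule sum.swap)
  also have "\<dots> = (\<Sum>j\<in>J. y j * (w \<bullet>c v j) * cnj (x \<bullet>c v j))"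
    by (intro sum.cong refl)
       (simp add: cscalar_prod_sum[OF v_carrier, of _ x] sum_distrib_left algebra_simps)
  finally show ?thesis .
qed

lemma gdet_eq_0:
  assumes "gdet y = 0"
  obtains w where "w \<in> carrier_vec N" "w \<noteq> 0\<^sub>v N" "(\<Sum>j\<in>J. y j * of_real ((cmod (w \<bullet>c v j))\<^sup>2)) = 0"
proof -
  obtain w where w: "w \<in> carrier_vec N" "w \<noteq> 0\<^sub>v N" "gram y *\<^sub>v w = 0\<^sub>v N"
    using assms det_0_iff_vec_prod_zero_field[OF gram_carrier] unfolding gdet_def by blast
  have "(\<Sum>j\<in>J. y j * of_real ((cmod (w \<bullet>c v j))\<^sup>2)) = (\<Sum>i<N. (gram y *\<^sub>v w) $ i * cnj (w $ i))"
    unfolding gram_form[OF w(1,1)] by (simp only: complex_norm_square mult.assoc)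
  also have "\<dots> = 0" using w by simp
  finally show thesis using w that by blast
qed

text \<open>The vector \<open>g\<close> is column \<open>i\<close> of the inverse of
  \<open>gram y\<close>; pairing with it through the form reads off a coordinate.\<close>

lemma gdet_nonzero_obtain:
  assumes "gdet y \<noteq> 0" "i < N"
  obtains g where "g \<in> carrier_vec N"
    "\<And>x. x \<in> carrier_vec N \<Longrightarrow> (\<Sum>j\<in>J. y j * (g \<bullet>c v j) * cnj (x \<bullet>c v j)) = cnj (x $ i)"
proof -
  obtain B where B: "B \<in> carrier_mat N N" "gram y * B = 1\<^sub>m N"
    using det_non_zero_imp_unit[OF gram_carrier assms(1)[unfolded gdet_def]]
    unfolding Units_def ring_mat_def by auto
  define g where "g = B *\<^sub>v unit_vec N i"
  have g: "g \<in> carrier_vec N" using B unfolding g_def by simp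
  have "gram y *\<^sub>v g = unit_vec N i"
    unfolding g_def using B(2) assoc_mult_mat_vec[OF gram_carrier B(1), of "unit_vec N i" y] by simp
  then have "(\<Sum>j\<in>J. y j * (g \<bullet>c v j) * cnj (x \<bullet>c v j)) = cnj (x $ i)" if "x \<in> carrier_vec N" for x
    unfolding gram_form[OF g that, symmetric] using assms(2)
    by (simp add: unit_vec_def if_distrib[of "\<lambda>z. z * _"] cong: if_cong)
  then show thesis using g that by blast
qed

text \<open>Changing one weight adds a multiple of a rank-one matrix.\<close>

lemma multiaffine_gdet: "multiaffine gdet"
  unfolding multiaffine_def
proof (intro allI)
  fix e y s
  show "gdet (y(e := y e + s)) = gdet y + s * pdiff e gdet y"
  proof (cases "e \<in> J")
    case False
    then have "gdet (y(e := y e + s)) = gdet y" for s by (intro gdet_cong) auto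
    from this[of s] this[of 1] show ?thesis by (simp add: pdiff_def)
  next
    case True
    have "gram (y(e := y e + s)) = mat N N (\<lambda>(r, c). gram y $$ (r, c) + s * (v e $ r * cnj (v e $ c)))" for s
    proof (rule eq_matI)
      fix r c assume "r < dim_row (mat N N (\<lambda>(r, c). gram y $$ (r, c) + s * (v e $ r * cnj (v e $ c))))"
         "c < dim_col (mat N N (\<lambda>(r, c). gram y $$ (r, c) + s * (v e $ r * cnj (v e $ c))))"
      then have rc: "r < N" "c < N" by auto
      have "(\<Sum>j\<in>J. (y(e := y e + s)) j * (v j $ r * cnj (v j $ c))) =
        (\<Sum>j\<in>J. y j * (v j $ r * cnj (v j $ c)) + (if j = e then s * (v e $ r * cnj (v e $ c)) else 0))"
        by (intro sum.cong) (auto simp: algebra_simps)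
      also have "\<dots> = (\<Sum>j\<in>J. y j * (v j $ r * cnj (v j $ c))) + s * (v e $ r * cnj (v e $ c))"
        using True finite_J by (simp add: sum.distrib)
      finally show "gram (y(e := y e + s)) $$ (r, c) 
        = mat N N (\<lambda>(r, c). gram y $$ (r, c) + s * (v e $ r * cnj (v e $ c))) $$ (r, c)"
        using rc by (simp add: gram_def)
    qed (auto simp: gram_def)
    then have *: "gdet (y(e := y e + s)) = det (mat N N (\<lambda>(r, c). gram y $$ (r, c) + s * (v e $ r * cnj (v e $ c))))" for s
      by (simp add: gdet_def)
    have "gdet (y(e := y e + s)) = gdet (y(e := y e + 0)) + s * (gdet (y(e := y e + 1)) - gdet (y(e := y e + 0)))"
      unfolding * by (rule det_rank_one_affine)
    then show ?thesis by (simp add: pdiff_def)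
  qed
qed

lemma gdet_cnj: "gdet (\<lambda>j. cnj (y j)) = cnj (gdet y)"
proof -
  interpret comm_ring_hom cnj by unfold_locales auto
  have "gram (\<lambda>j. cnj (y j)) = map_mat cnj (transpose_mat (gram y))"
    by (intro eq_matI) (auto simp: gram_def mult.commute)
  then show ?thesis
    by (simp add: gdet_def hom_det det_transpose[OF gram_carrier])
qed

lemma gdet_diag: "\<exists>f. degree f \<le> N \<and> coeff f N = gdet (\<lambda>_. 1) \<and> (\<forall>x. gdet (\<lambda>e. u e + x) = poly f x)"
  using det_linear_pencil[of N "\<lambda>r c. \<Sum>j\<in>J. v j $ r * cnj (v j $ c)" "\<lambda>r c. \<Sum>j\<in>J. u j * (v j $ r * cnj (v j $ c))"]
  by (simp add: gdet_def gram_def sum.distrib sum_distrib_left algebra_simps)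

end

section \<open>Frames and the two-block determinant\<close>

locale frame = vector_system +
  fixes \<alpha> \<beta> :: real
  assumes \<alpha>: "\<alpha> > 0"
    and lower: "w \<in> carrier_vec N \<Longrightarrow> \<alpha> * (euclid_norm w)\<^sup>2 \<le> (\<Sum>j\<in>J. (cmod (w \<bullet>c v j))\<^sup>2)"
    and upper: "w \<in> carrier_vec N \<Longrightarrow> (\<Sum>j\<in>J. (cmod (w \<bullet>c v j))\<^sup>2) \<le> \<beta> * (euclid_norm w)\<^sup>2"
begin

lemma weighted_pos:
  assumes y: "\<And>j. j \<in> J \<Longrightarrow> y j > (0::real)" and w: "w \<in> carrier_vec N" "w \<noteq> 0\<^sub>v N"
  shows "(\<Sum>j\<in>J. y j * (cmod (w \<bullet>c v j))\<^sup>2) > 0"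
proof -
  have "(\<Sum>j\<in>J. (cmod (w \<bullet>c v j))\<^sup>2) > 0"
    using lower[OF w(1)] mult_pos_pos[OF \<alpha> euclid_norm_sq_pos[OF w]] by linarith
  then have "\<exists>j\<in>J. (cmod (w \<bullet>c v j))\<^sup>2 > 0"
    using sum_nonpos[of J "\<lambda>j. (cmod (w \<bullet>c v j))\<^sup>2"] not_le by blast
  then obtain j where j: "j \<in> J" "(cmod (w \<bullet>c v j))\<^sup>2 > 0" by blast
  show ?thesis
    using j y finite_J by (intro sum_pos2[of J j]) (auto simp: less_imp_le)
qed

text \<open>A kernel vector would make the form vanish, but its imaginary part is a sum with
  positive weights, which the lower frame bound makes positive.\<close>

lemma gdet_stable:
  assumes "\<And>j. j \<in> J \<Longrightarrow> Im (y j) > 0"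
  shows "gdet y \<noteq> 0"
proof
  assume "gdet y = 0"
  then obtain w where w: "w \<in> carrier_vec N" "w \<noteq> 0\<^sub>v N" and 
    0: "(\<Sum>j\<in>J. y j * of_real ((cmod (w \<bullet>c v j))\<^sup>2)) = 0" by (rule gdet_eq_0)
  have "(\<Sum>j\<in>J. Im (y j) * (cmod (w \<bullet>c v j))\<^sup>2) = Im (\<Sum>j\<in>J. y j * of_real ((cmod (w \<bullet>c v j))\<^sup>2))"
    by (simp only: Im_sum) (simp add: complex_mult_cnj)
  also have "\<dots> = 0" unfolding 0 by simp
  finally show False using weighted_pos[of "\<lambda>j. Im (y j)", OF assms w] by simp
qed

lemma gdet_eq_0_real:
  assumes "gdet (\<lambda>j. of_real (y j)) = 0"
  obtains w where "w \<in> carrier_vec N" "w \<noteq> 0\<^sub>v N" "(\<Sum>j\<in>J. y j * (cmod (w \<bullet>c v j))\<^sup>2) = 0"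
proof -
  obtain w where w: "w \<in> carrier_vec N" "w \<noteq> 0\<^sub>v N" and 
    0: "(\<Sum>j\<in>J. of_real (y j) * complex_of_real ((cmod (w \<bullet>c v j))\<^sup>2)) = 0" using assms by (rule gdet_eq_0)
  have "complex_of_real (\<Sum>j\<in>J. y j * (cmod (w \<bullet>c v j))\<^sup>2) = 0"
    using 0 by simp
  then show thesis using w that of_real_eq_0_iff by blast
qed

lemma gdet_pos_nonzero:
  assumes "\<And>j. j \<in> J \<Longrightarrow> y j > (0::real)"
  shows "gdet (\<lambda>j. of_real (y j)) \<noteq> 0"
proof
  assume "gdet (\<lambda>j. of_real (y j)) = 0"
  then obtain w where "w \<in> carrier_vec N" "w \<noteq> 0\<^sub>v N" "(\<Sum>j\<in>J. y j * (cmod (w \<bullet>c v j))\<^sup>2) = 0"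
    by (rule gdet_eq_0_real)
  then show False using weighted_pos[OF assms] by force
qed

text \<open>The two families of variables record the two blocks into which each vector may be put.\<close>

definition pair_det :: "('a \<times> bool \<Rightarrow> complex) \<Rightarrow> complex" where
  "pair_det y = gdet (\<lambda>j. y (j, True)) * gdet (\<lambda>j. y (j, False))"

lemma multiaffine_pair_det: "multiaffine pair_det"
  unfolding multiaffine_def
proof (intro allI)
  fix e :: "'a \<times> bool" and y :: "'a \<times> bool \<Rightarrow> complex" and s :: complex
  obtain j b where e: "e = (j, b)" by (cases e)
  define x where "x = (\<lambda>i. y (i, b))"
  have *: "pair_det (y(e := y e + t)) = (gdet x + t * pdiff j gdet x) * gdet (\<lambda>i. y (i, \<not> b))" for t
  proof -
    have "(\<lambda>i. (y(e := y e + t)) (i, c)) = (if b = c then x(j := x j + t) else (\<lambda>i. y (i, c)))" for c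
      by (auto simp: fun_eq_iff e x_def)
    then have "pair_det (y(e := y e + t)) = gdet (x(j := x j + t)) * gdet (\<lambda>i. y (i, \<not> b))"
      unfolding pair_det_def by (cases b) (simp_all add: mult.commute)
    then show ?thesis unfolding multiaffineD[OF multiaffine_gdet] .
  qed
  have "pair_det y = gdet x * gdet (\<lambda>i. y (i, \<not> b))"
    using *[of 0] by simp
  then show "pair_det (y(e := y e + s)) = pair_det y + s * pdiff e pair_det y"
    unfolding pdiff_def[of e] * by (simp add: algebra_simps)
qed

text \<open>The leading coefficient is the square of a nonzero real number, so its sign is known
  without that of \<open>gdet\<close>.\<close>

lemma stable_poly_pair_det:
  "\<exists>L>0. stable_poly (N + N) L pair_det"
proof -
  let ?d = "gdet (\<lambda>_. 1)"
  have d0: "?d \<noteq> 0" using gdet_pos_nonzero[of "\<lambda>_. 1"] by simp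
  have "?d \<in> \<real>" using gdet_cnj[of "\<lambda>_. 1"] by (simp add: Reals_cnj_iff)
  then obtain r where r: "?d = of_real r" by (auto elim: Reals_cases)
  have "\<exists>f. degree f \<le> N + N \<and> coeff f (N + N) = of_real (r * r) \<and> (\<forall>x. pair_det (\<lambda>e. u e + x) = poly f x)" for u
  proof -
    obtain f where f: "degree f \<le> N" "coeff f N = ?d" "\<And>x. gdet (\<lambda>j. u (j, True) + x) = poly f x"
      using gdet_diag[of "\<lambda>j. u (j, True)"] by auto
    obtain g where g: "degree g \<le> N" "coeff g N = ?d" "\<And>x. gdet (\<lambda>j. u (j, False) + x) = poly g x"
      using gdet_diag[of "\<lambda>j. u (j, False)"] by auto
    have "degree (f * g) \<le> N + N" using degree_mult_le[of f g] f(1) g(1) by linarith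
    moreover have "coeff (f * g) (N + N) = of_real (r * r)"
    proof -
      have "degree f = N" "degree g = N"
        using f(1,2) g(1,2) d0 le_degree[of f N] le_degree[of g N] by auto
      then show ?thesis using coeff_mult_degree_sum[of f g] f(2) g(2) r by simp
    qed
    ultimately show ?thesis using f(3) g(3) by (intro exI[of _ "f * g"]) (simp add: pair_det_def)
  qed
  then have "stable_poly (N + N) (r * r) pair_det"
    unfolding stable_poly_def
    using multiaffine_pair_det gdet_cnj gdet_stable by (auto simp: pair_det_def)
  moreover have "r * r > 0" using d0 r by (cases "r < 0") (auto simp: zero_less_mult_iff)
  ultimately show ?thesis by blast
qed

text \<open>On the diagonal line through the point the polynomial is real-rooted with positive
  leading coefficient. Positive weights exclude roots in \<open>[0, \<infinity>)\<close>, so its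
  constant coefficient, the value at the point, is positive.\<close>

lemma above_pair_det:
  assumes y: "\<And>e. fst e \<in> J \<Longrightarrow> y e > 0"
  shows "above (real_version pair_det) y"
  unfolding above_def
proof (intro allI impI)
  fix w :: "'a \<times> bool \<Rightarrow> real" assume w: "\<forall>e. w e \<ge> 0"
  obtain L where L: "L > 0" "stable_poly (N + N) L pair_det" using stable_poly_pair_det by blast
  let ?z = "\<lambda>e. y e + w e"
  obtain f where f: "degree f \<le> N + N" "coeff f (N + N) = of_real L" 
     "\<And>x. pair_det (\<lambda>e. of_real (?z e) + x) = poly f x"
    using stable_polyD(4)[OF L(2), of "\<lambda>e. of_real (?z e)"] by auto
  have deg: "degree f = N + N" using f L le_degree[of f "N + N"] by auto
  have "pos_real (coeff f 0)"
  proof (rule coeff_neg_rooted)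
    show "pos_real (lead_coeff f)" using f L deg by (simp add: pos_real_def)
    fix x assume x: "poly f x = 0"
    then have "pair_det (\<lambda>e. of_real (?z e) + x) = 0" by (simp only: f(3))
    then have "x \<in> \<real>" by (rule stable_poly_real_rooted[OF L(2)])
    then obtain r where r: "x = of_real r" by (auto elim: Reals_cases)
    have "r < 0"
    proof (rule ccontr)
      assume "\<not> r < 0"
      then have "?z (j, b) + r > 0" if "j \<in> J" for j b
        using y[of "(j, b)"] w[rule_format, of "(j, b)"] that \<open>\<not> r < 0\<close> by simp
      then have "gdet (\<lambda>j. of_real (?z (j, b) + r)) \<noteq> 0" for b
        by (rule gdet_pos_nonzero)
      then have "poly f x \<noteq> 0" by (simp add: pair_det_def r flip: f(3))
      then show False using x by simp
    qed
    then show "pos_real (- x)" by (simp add: pos_real_def r)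
  qed simp
  then show "real_version pair_det ?z > 0"
    using f(3)[of 0] by (simp add: real_version_def pos_real_def poly_0_coeff_0)
qed

text \<open>Instead of inverting a matrix, the variable \<open>(j, b)\<close> is lowered by
  \<open>1 / \<Phi>\<close>, which makes the affine function vanish. A kernel vector
  \<open>w\<close> there satisfies
  \<open>\<Phi> * x0 * B = (cmod (w \<bullet>c v j))\<^sup>2\<close>, with \<open>B\<close> the
  unweighted form at \<open>w\<close>; Cauchy-Schwarz and the lower frame bound finish.\<close>

lemma barrier_pair_det_le:
  assumes x0: "x0 > 0" and y: "\<And>e. fst e \<in> J \<Longrightarrow> y e = x0" and j: "j \<in> J"
    and small: "(euclid_norm (v j))\<^sup>2 \<le> \<epsilon> * \<alpha>" and \<epsilon>: "\<epsilon> > 0"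
  shows "barrier (j, b) (real_version pair_det) y \<le> \<epsilon> / x0"
proof (cases "barrier (j, b) (real_version pair_det) y \<le> 0")
  case True
  then show ?thesis using x0 \<epsilon> by (smt (verit) divide_pos_pos)
next
  case False
  let ?p = "real_version pair_det"
  define \<Phi> where "\<Phi> = barrier (j, b) ?p y"
  have \<Phi>: "\<Phi> > 0" using False by (simp add: \<Phi>_def)
  obtain L where L: "L > 0" "stable_poly (N + N) L pair_det" using stable_poly_pair_det by blast
  have ppos: "?p y > 0" by (rule above_pos[OF above_pair_det]) (use y x0 in auto)
  define z where "z = y((j, b) := y (j, b) + (- 1 / \<Phi>))"
  have "?p z = ?p y + (- 1 / \<Phi>) * pdiff (j, b) ?p y"
    unfolding z_def by (rule multiaffineD[OF multiaffine_real_version[OF stable_polyD(1)[OF L(2)]]])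
  also have "pdiff (j, b) ?p y = \<Phi> * ?p y" using ppos by (simp add: \<Phi>_def barrier_def)
  finally have "?p z = 0" using \<Phi> by simp
  then have "pair_det (\<lambda>e. of_real (z e)) = 0" using real_version_eq[OF L(2)] by simp
  moreover have "gdet (\<lambda>i. of_real (z (i, \<not> b))) \<noteq> 0"
    by (rule gdet_pos_nonzero) (use y x0 in \<open>auto simp: z_def\<close>)
  ultimately have "gdet (\<lambda>i. of_real (z (i, b))) = 0" 
    by (cases b) (auto simp: pair_det_def)
  then obtain w where w: "w \<in> carrier_vec N" "w \<noteq> 0\<^sub>v N" and 
    0: "(\<Sum>i\<in>J. z (i, b) * (cmod (w \<bullet>c v i))\<^sup>2) = 0" by (rule gdet_eq_0_real)
  have "(\<Sum>i\<in>J. z (i, b) * (cmod (w \<bullet>c v i))\<^sup>2)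
     = (\<Sum>i\<in>J. x0 * (cmod (w \<bullet>c v i))\<^sup>2 + (if i = j then - 1 / \<Phi> * (cmod (w \<bullet>c v j))\<^sup>2 else 0))"
    by (intro sum.cong) (auto simp: z_def y algebra_simps)
  also have "\<dots> = x0 * (\<Sum>i\<in>J. (cmod (w \<bullet>c v i))\<^sup>2) - 1 / \<Phi> * (cmod (w \<bullet>c v j))\<^sup>2"
    using finite_J j by (simp add: sum.distrib sum_distrib_left)
  finally have "x0 * (\<Sum>i\<in>J. (cmod (w \<bullet>c v i))\<^sup>2) = 1 / \<Phi> * (cmod (w \<bullet>c v j))\<^sup>2"
    using 0 by simp
  then have "\<Phi> * x0 * (\<Sum>i\<in>J. (cmod (w \<bullet>c v i))\<^sup>2) = (cmod (w \<bullet>c v j))\<^sup>2"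
    using \<Phi> by (simp add: field_simps)
  moreover have "\<Phi> * x0 * (\<alpha> * (euclid_norm w)\<^sup>2) \<le> \<Phi> * x0 * (\<Sum>i\<in>J. (cmod (w \<bullet>c v i))\<^sup>2)"
    using lower[OF w(1)] \<Phi> x0 by (intro mult_left_mono) auto
  moreover have "(cmod (w \<bullet>c v j))\<^sup>2 \<le> \<epsilon> * \<alpha> * (euclid_norm w)\<^sup>2"
    using cscalar_prod_Cauchy_Schwarz[OF v_carrier[OF j] w(1)]
      mult_right_mono[OF small, of "(euclid_norm w)\<^sup>2"] by simp
  ultimately have "(\<Phi> * x0) * (\<alpha> * (euclid_norm w)\<^sup>2) \<le> \<epsilon> * (\<alpha> * (euclid_norm w)\<^sup>2)"
    by simp
  then have "\<Phi> * x0 \<le> \<epsilon>"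
    using mult_pos_pos[OF \<alpha> euclid_norm_sq_pos[OF w]] by (rule mult_right_le_imp_le)
  then show ?thesis using x0 by (simp add: \<Phi>_def pos_le_divide_eq)
qed

end

section \<open>From nonsingularity to positive semidefiniteness\<close>

context vector_system begin

text \<open>The form at \<open>w - r h x\<close>, with \<open>h\<close> the mixed term, is a
  nonnegative quadratic in real \<open>r\<close>; the factor \<open>h\<close> makes the cross term
  real. The discriminant gives the claim times \<open>(cmod h)\<^sup>2\<close>.\<close>

lemma psd_Cauchy_Schwarz:
  fixes c :: "'a \<Rightarrow> real"
  assumes psd: "\<And>w. w \<in> carrier_vec N \<Longrightarrow> (\<Sum>j\<in>J. c j * (cmod (w \<bullet>c v j))\<^sup>2) \<ge> 0"
    and x: "x \<in> carrier_vec N" and w: "w \<in> carrier_vec N"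
  shows "(cmod (\<Sum>j\<in>J. of_real (c j) * (w \<bullet>c v j) * cnj (x \<bullet>c v j)))\<^sup>2
    \<le> (\<Sum>j\<in>J. c j * (cmod (x \<bullet>c v j))\<^sup>2) * (\<Sum>j\<in>J. c j * (cmod (w \<bullet>c v j))\<^sup>2)"
proof -
  define Q where "Q w = (\<Sum>j\<in>J. c j * (cmod (w \<bullet>c v j))\<^sup>2)" for w
  define h where "h = (\<Sum>j\<in>J. of_real (c j) * (w \<bullet>c v j) * cnj (x \<bullet>c v j))"
  have "Q (w + t \<cdot>\<^sub>v x) = Q w + 2 * Re (cnj t * h) + (cmod t)\<^sup>2 * Q x" for t
  proof -
    have sq: "(cmod (a + t * b))\<^sup>2 = (cmod a)\<^sup>2 + 2 * Re (cnj t * (a * cnj b)) + (cmod t)\<^sup>2 * (cmod b)\<^sup>2" for a b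
      by (simp add: cmod_power2 power_mult_distrib) (simp add: power2_eq_square algebra_simps)
    have "(w + t \<cdot>\<^sub>v x) \<bullet>c v j = w \<bullet>c v j + t * (x \<bullet>c v j)" if "j \<in> J" for j
      using v_carrier[OF that] x w 
      by (simp add: cscalar_prod_sum[OF v_carrier[OF that]] algebra_simps sum.distrib sum_distrib_left)
    then have "Q (w + t \<cdot>\<^sub>v x) = (\<Sum>j\<in>J. c j * (cmod (w \<bullet>c v j + t * (x \<bullet>c v j)))\<^sup>2)"
      unfolding Q_def by (intro sum.cong) auto
    also have "\<dots> = Q w + 2 * Re (cnj t * h) + (cmod t)\<^sup>2 * Q x"
      unfolding Q_def h_def sq
      by (simp add: sum_distrib_left sum.distrib algebra_simps sum_subtractf)
    finally show ?thesis .
  qed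
  note expand = this
  have "0 \<le> Q w - 2 * r * (cmod h)\<^sup>2 + r\<^sup>2 * (cmod h)\<^sup>2 * Q x" for r
  proof -
    have "Q (w + (- of_real r * h) \<cdot>\<^sub>v x) \<ge> 0" unfolding Q_def using x w by (intro psd) auto
    also have "Q (w + (- of_real r * h) \<cdot>\<^sub>v x) = Q w - 2 * r * (cmod h)\<^sup>2 + r\<^sup>2 * (cmod h)\<^sup>2 * Q x"
    proof -
      have "cnj (- of_real r * h) * h = - of_real (r * (cmod h)\<^sup>2)"
        by (simp only: of_real_mult complex_norm_square) simp
      then show ?thesis unfolding expand by (simp only:) (simp add: norm_mult power_mult_distrib)
    qed
    finally show ?thesis .
  qed
  then have "- Q w + (2 * (cmod h)\<^sup>2) * r + (- ((cmod h)\<^sup>2 * Q x)) * r\<^sup>2 \<le> 0" for r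
    by (simp add: algebra_simps)
  from nonpos_quadratic_discrim(3)[OF this]
  have le: "(cmod h)\<^sup>2 * (cmod h)\<^sup>2 \<le> (cmod h)\<^sup>2 * (Q x * Q w)"
    by (simp add: power2_eq_square algebra_simps)
  have "(cmod h)\<^sup>2 \<le> Q x * Q w"
  proof (cases "h = 0")
    case True
    then show ?thesis using psd[OF x] psd[OF w] by (simp add: Q_def)
  next
    case False
    then have "(cmod h)\<^sup>2 > 0" by simp
    then show ?thesis using le by (simp only: mult_le_cancel_left_pos)
  qed
  then show ?thesis by (simp add: Q_def h_def)
qed

text \<open>Each coordinate of \<open>w\<close> is a pairing with a fixed \<open>g i\<close>, so
  Cauchy-Schwarz bounds it by the form. Summing over \<open>i\<close> gives an explicit
  \<open>\<gamma>\<close> without compactness.\<close>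

lemma psd_nonsingular_imp_pd:
  fixes c :: "'a \<Rightarrow> real"
  assumes psd: "\<And>w. w \<in> carrier_vec N \<Longrightarrow> (\<Sum>j\<in>J. c j * (cmod (w \<bullet>c v j))\<^sup>2) \<ge> 0"
    and nz: "gdet (\<lambda>j. of_real (c j)) \<noteq> 0"
  obtains \<gamma> where "\<gamma> > 0"
    "\<And>w. w \<in> carrier_vec N \<Longrightarrow> \<gamma> * (euclid_norm w)\<^sup>2 \<le> (\<Sum>j\<in>J. c j * (cmod (w \<bullet>c v j))\<^sup>2)"
proof -
  define Q where "Q w = (\<Sum>j\<in>J. c j * (cmod (w \<bullet>c v j))\<^sup>2)" for w
  have "\<exists>g\<in>carrier_vec N. \<forall>x\<in>carrier_vec N. 
      (\<Sum>j\<in>J. of_real (c j) * (g \<bullet>c v j) * cnj (x \<bullet>c v j)) = cnj (x $ i)" if "i < N" for i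
    using gdet_nonzero_obtain[OF nz that] by metis
  then obtain g where g: "\<And>i. i < N \<Longrightarrow> g i \<in> carrier_vec N"
    "\<And>i x. i < N \<Longrightarrow> x \<in> carrier_vec N \<Longrightarrow> 
      (\<Sum>j\<in>J. of_real (c j) * (g i \<bullet>c v j) * cnj (x \<bullet>c v j)) = cnj (x $ i)"
    by metis
  define \<Gamma> where "\<Gamma> = (\<Sum>i<N. Q (g i)) + 1"
  have Qg: "Q (g i) \<ge> 0" if "i < N" for i using psd g(1) that by (simp add: Q_def)
  then have \<Gamma>: "\<Gamma> > 0" unfolding \<Gamma>_def by (intro add_nonneg_pos sum_nonneg) auto
  have "1 / \<Gamma> * (euclid_norm w)\<^sup>2 \<le> Q w" if w: "w \<in> carrier_vec N" for w
  proof -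
    have "(cmod (w $ i))\<^sup>2 \<le> Q w * Q (g i)" if "i < N" for i
      using psd_Cauchy_Schwarz[OF psd w g(1)[OF that]] g(2)[OF that w] by (simp add: Q_def)
    then have "(euclid_norm w)\<^sup>2 \<le> (\<Sum>i<N. Q w * Q (g i))"
      unfolding euclid_norm_sq[OF w] by (intro sum_mono) auto
    also have "\<dots> \<le> Q w * \<Gamma>"
      using psd[OF w] by (simp add: \<Gamma>_def Q_def algebra_simps flip: sum_distrib_left)
    finally show ?thesis using \<Gamma> by (simp add: field_simps)
  qed
  then show thesis using \<Gamma> that[of "1 / \<Gamma>"] by (simp add: Q_def)
qed

end

context frame begin

text \<open>At the last point of the ray where the form is not positive definite, it is still positive
  semidefinite, hence singular.\<close>

lemma nonsingular_ray_imp_psd: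
  fixes c :: "'a \<Rightarrow> real"
  assumes nz: "\<And>x. x \<ge> 0 \<Longrightarrow> gdet (\<lambda>j. of_real (c j + x)) \<noteq> 0" and w: "w \<in> carrier_vec N"
  shows "(\<Sum>j\<in>J. c j * (cmod (w \<bullet>c v j))\<^sup>2) \<ge> 0"
proof (rule ccontr)
  define B where "B w = (\<Sum>j\<in>J. (cmod (w \<bullet>c v j))\<^sup>2)" for w
  define Q where "Q x w = (\<Sum>j\<in>J. (c j + x) * (cmod (w \<bullet>c v j))\<^sup>2)" for x w
  have Qadd: "Q (x + t) w = Q x w + t * B w" for x t w
    by (simp add: Q_def B_def algebra_simps sum.distrib sum_distrib_left)
  have B0: "B w \<ge> 0" for w by (simp add: B_def sum_nonneg)
  define X where "X = {x. x \<ge> 0 \<and> (\<exists>w\<in>carrier_vec N. Q x w < 0)}"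
  assume "\<not> (\<Sum>j\<in>J. c j * (cmod (w \<bullet>c v j))\<^sup>2) \<ge> 0"
  then have 0: "0 \<in> X" using w by (auto simp: X_def Q_def not_le)
  have "x \<le> (\<Sum>j\<in>J. \<bar>c j\<bar>)" if "x \<in> X" for x
  proof (rule ccontr)
    assume x: "\<not> x \<le> (\<Sum>j\<in>J. \<bar>c j\<bar>)"
    have "c j + x \<ge> 0" if "j \<in> J" for j
      using member_le_sum[of j J "\<lambda>j. \<bar>c j\<bar>"] that finite_J x by force
    then have "Q x w \<ge> 0" for w by (simp add: Q_def sum_nonneg)
    then show False using that unfolding X_def by (simp add: not_less[symmetric])
  qed
  then have bdd: "bdd_above X" by (rule bdd_aboveI)
  define \<rho> where "\<rho> = Sup X"
  have \<rho>0: "\<rho> \<ge> 0" unfolding \<rho>_def using 0 bdd by (rule cSup_upper)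
  have psd: "Q \<rho> w \<ge> 0" if w: "w \<in> carrier_vec N" for w
  proof (rule ccontr)
    assume neg: "\<not> Q \<rho> w \<ge> 0"
    \<comment> \<open>Small enough that the form at \<open>w\<close> stays negative at
      \<open>\<rho> + t\<close>.\<close>
    define t where "t = - Q \<rho> w / (2 * (B w + 1))"
    have t: "t > 0" unfolding t_def using neg B0[of w] by (intro divide_pos_pos) auto
    have "t * B w \<le> t * (B w + 1)" using t by simp
    also have "\<dots> = - Q \<rho> w / 2" using B0[of w] by (simp add: t_def field_simps)
    finally have "Q (\<rho> + t) w < 0" unfolding Qadd using neg by linarith
    then have "\<rho> + t \<in> X" using w \<rho>0 t by (auto simp: X_def)
    then have "\<rho> + t \<le> \<rho>" unfolding \<rho>_def using bdd by (rule cSup_upper)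
    then show False using t by simp
  qed
  obtain \<gamma> where \<gamma>: "\<gamma> > 0" "\<And>w. w \<in> carrier_vec N \<Longrightarrow> \<gamma> * (euclid_norm w)\<^sup>2 \<le> Q \<rho> w"
    using psd_nonsingular_imp_pd[of "\<lambda>j. c j + \<rho>", OF psd[unfolded Q_def] nz[OF \<rho>0]]
    unfolding Q_def by blast
  \<comment> \<open>Lowering the parameter by at most \<open>\<tau>\<close> costs at most
    \<open>\<gamma>\<close> times the squared norm, so no negative direction can appear just below
    \<open>\<rho>\<close>.\<close>
  define \<tau> where "\<tau> = \<gamma> / (\<bar>\<beta>\<bar> + 1)"
  have \<tau>: "\<tau> > 0" using \<gamma> by (simp add: \<tau>_def)
  obtain x where x: "x \<in> X" "\<rho> - \<tau> < x"
    using less_cSup_iff[of X "\<rho> - \<tau>"] 0 bdd \<tau> unfolding \<rho>_def by auto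
  have x\<rho>: "x \<le> \<rho>" unfolding \<rho>_def using x(1) bdd by (rule cSup_upper)
  obtain w where w: "w \<in> carrier_vec N" "Q x w < 0" using x(1) by (auto simp: X_def)
  have "Q \<rho> w = Q x w + (\<rho> - x) * B w" using Qadd[of x "\<rho> - x" w] by simp
  also have "(\<rho> - x) * B w \<le> \<tau> * ((\<bar>\<beta>\<bar> + 1) * (euclid_norm w)\<^sup>2)"
  proof (rule mult_mono)
    have "\<beta> * (euclid_norm w)\<^sup>2 \<le> (\<bar>\<beta>\<bar> + 1) * (euclid_norm w)\<^sup>2"
      by (intro mult_right_mono) auto
    then show "B w \<le> (\<bar>\<beta>\<bar> + 1) * (euclid_norm w)\<^sup>2"
      using upper[OF w(1)] by (simp add: B_def)
  qed (use x B0 \<tau> in auto)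
  also have "\<tau> * ((\<bar>\<beta>\<bar> + 1) * (euclid_norm w)\<^sup>2) = \<gamma> * (euclid_norm w)\<^sup>2"
    by (simp add: \<tau>_def)
  finally show False using \<gamma>(2)[OF w(1)] w(2) by linarith
qed

text \<open>The point \<open>(x - \<delta>, \<dots>, x - \<delta>)\<close> with \<open>x \<ge> (1 + \<eta>)\<^sup>2\<close> and \<open>\<delta> = 1 + \<eta>\<close> satisfies the hypothesis of the
  barrier argument, since \<open>(1 + \<eta>)\<^sup>2 - \<delta> = \<eta> (1 + \<eta>)\<close> and \<open>2 \<epsilon> / (\<eta> (1 + \<eta>)) = 1 - 1 / \<delta>\<close> for \<open>\<epsilon> = \<eta>\<^sup>2 / 2\<close>.\<close>

theorem balanced_partition:
  assumes small: "\<And>j. j \<in> J \<Longrightarrow> (euclid_norm (v j))\<^sup>2 \<le> \<eta>\<^sup>2 / 2 * \<alpha>" and \<eta>: "\<eta> > 0"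
  obtains S where "S \<subseteq> J"
    "\<And>w. w \<in> carrier_vec N \<Longrightarrow> (\<Sum>j\<in>S. (cmod (w \<bullet>c v j))\<^sup>2) \<le> (1 + \<eta>)\<^sup>2 / 2 * (\<Sum>j\<in>J. (cmod (w \<bullet>c v j))\<^sup>2)"
    "\<And>w. w \<in> carrier_vec N \<Longrightarrow> (\<Sum>j\<in>J - S. (cmod (w \<bullet>c v j))\<^sup>2) \<le> (1 + \<eta>)\<^sup>2 / 2 * (\<Sum>j\<in>J. (cmod (w \<bullet>c v j))\<^sup>2)"
proof -
  define \<epsilon> where "\<epsilon> = \<eta>\<^sup>2 / 2"
  define \<delta> where "\<delta> = 1 + \<eta>"
  define \<mu> where "\<mu> = (1 + \<eta>)\<^sup>2"
  have \<epsilon>: "\<epsilon> > 0" and \<delta>: "\<delta> > 0" using \<eta> by (auto simp: \<epsilon>_def \<delta>_def)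
  obtain L where L: "L > 0" "stable_poly (N + N) L pair_det" using stable_poly_pair_det by blast
  obtain js where js: "set js = J" "distinct js" using finite_distinct_list[OF finite_J] by blast
  have nz: "mixed js pair_det (\<lambda>_. of_real x) \<noteq> 0" if x: "x \<ge> \<mu>" for x
  proof -
    define x0 where "x0 = x - \<delta>"
    have "\<mu> - \<delta> = \<eta> * (1 + \<eta>)" by (simp add: \<mu>_def \<delta>_def power2_eq_square algebra_simps)
    then have x0: "x0 \<ge> \<eta> * (1 + \<eta>)" using x by (simp add: x0_def)
    have "\<eta> * (1 + \<eta>) > 0" using \<eta> by simp
    then have x0_pos: "x0 > 0" using x0 by linarith
    define y where "y e = (if fst e \<in> J then x0 else x)" for e :: "'a \<times> bool"
    have y: "y e = x0" if "fst e \<in> J" for e using that by (simp add: y_def)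
    have "above (real_version (mixed js pair_det)) (\<lambda>e. if fst e \<in> set js then y e + \<delta> else y e)"
    proof (rule mixed_above[OF L(2) js(2) \<delta>])
      show "above (real_version pair_det) y" using y x0_pos by (intro above_pair_det) auto
      fix j assume "j \<in> set js"
      then have j: "j \<in> J" by (simp add: js)
      have "barrier (j, b) (real_version pair_det) y \<le> \<epsilon> / x0" for b
        using small[OF j] by (intro barrier_pair_det_le x0_pos y j \<epsilon>) (simp_all add: \<epsilon>_def)
      from this[of True] this[of False]
      have "barrier (j, True) (real_version pair_det) y + barrier (j, False) (real_version pair_det) y \<le> 2 * \<epsilon> / x0"
        by simp
      also have "\<dots> \<le> 2 * \<epsilon> / (\<eta> * (1 + \<eta>))"
        using x0 x0_pos \<epsilon> \<eta> by (intro divide_left_mono mult_pos_pos) auto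
      also have "\<dots> = 1 - 1 / \<delta>"
      proof -
        have "2 * \<epsilon> / (\<eta> * (1 + \<eta>)) = \<eta> / (1 + \<eta>)"
          using \<eta> by (simp add: \<epsilon>_def power2_eq_square)
        also have "\<dots> = 1 - 1 / \<delta>" using \<eta> by (simp add: \<delta>_def field_simps)
        finally show ?thesis .
      qed
      finally show "barrier (j, True) (real_version pair_det) y + barrier (j, False) (real_version pair_det) y \<le> 1 - 1 / \<delta>" .
    qed
    also have "(\<lambda>e. if fst e \<in> set js then y e + \<delta> else y e) = (\<lambda>_. x)"
      by (auto simp: y_def js x0_def)
    finally have "real_version (mixed js pair_det) (\<lambda>_. x) > 0" by (rule above_pos)
    then show ?thesis by (auto simp: real_version_def)
  qed
  obtain ch where ch: "\<And>x. x \<ge> \<mu> \<Longrightarrow>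
      pair_det (\<lambda>e. of_real x - (if fst e \<in> set js \<and> snd e = ch (fst e) then 2 else 0)) \<noteq> 0"
    using interlacing_family_choice[OF L(2,1) js(2) nz] by blast
  define S where "S b = {j \<in> J. ch j = b}" for b
  have bound: "(\<Sum>j\<in>S b. (cmod (w \<bullet>c v j))\<^sup>2) \<le> \<mu> / 2 * (\<Sum>j\<in>J. (cmod (w \<bullet>c v j))\<^sup>2)"
    if w: "w \<in> carrier_vec N" for w b
  proof -
    \<comment> \<open>Nonvanishing of the product on the ray from \<open>\<mu>\<close> means
      nonvanishing for each block separately.\<close>
    have "(\<Sum>j\<in>J. (\<mu> - (if j \<in> S b then 2 else 0)) * (cmod (w \<bullet>c v j))\<^sup>2) \<ge> 0"
    proof (rule nonsingular_ray_imp_psd[OF _ w])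
      fix x :: real assume "x \<ge> 0"
      then have "pair_det (\<lambda>e. of_real (\<mu> + x) - (if fst e \<in> set js \<and> snd e = ch (fst e) then 2 else 0)) \<noteq> 0"
        by (intro ch) simp
      then have "gdet (\<lambda>j. of_real (\<mu> + x) - (if j \<in> J \<and> b = ch j then 2 else 0)) \<noteq> 0"
        unfolding pair_det_def js(1) by (cases b) auto
      also have "(\<lambda>j. complex_of_real (\<mu> + x) - (if j \<in> J \<and> b = ch j then 2 else 0))
          = (\<lambda>j. of_real (\<mu> - (if j \<in> S b then 2 else 0) + x))"
        by (auto simp: S_def fun_eq_iff)
      finally show "gdet (\<lambda>j. of_real (\<mu> - (if j \<in> S b then 2 else 0) + x)) \<noteq> 0" .
    qed
    also have "(\<Sum>j\<in>J. (\<mu> - (if j \<in> S b then 2 else 0)) * (cmod (w \<bullet>c v j))\<^sup>2)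
        = (\<Sum>j\<in>J. \<mu> * (cmod (w \<bullet>c v j))\<^sup>2 - 2 * (if j \<in> S b then (cmod (w \<bullet>c v j))\<^sup>2 else 0))"
      by (intro sum.cong) (auto simp: algebra_simps)
    also have "\<dots> = \<mu> * (\<Sum>j\<in>J. (cmod (w \<bullet>c v j))\<^sup>2) - 2 * (\<Sum>j\<in>S b. (cmod (w \<bullet>c v j))\<^sup>2)"
    proof -
      have "(\<Sum>j\<in>J. if j \<in> S b then (cmod (w \<bullet>c v j))\<^sup>2 else 0) = (\<Sum>j\<in>S b. (cmod (w \<bullet>c v j))\<^sup>2)"
        using sum.inter_restrict[OF finite_J, of "\<lambda>j. (cmod (w \<bullet>c v j))\<^sup>2" "S b"]
          Int_absorb1[of "S b" J] by (simp add: S_def)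
      then show ?thesis by (simp add: sum_subtractf flip: sum_distrib_left)
    qed
    finally show ?thesis by simp
  qed
  have "J - S True = S False" by (auto simp: S_def)
  then show thesis
    using that[of "S True"] bound[of _ True] bound[of _ False] by (auto simp: S_def \<mu>_def)
qed

end

subsection \<open>Iterated halving\<close>

text \<open>Each halving adds a relative error of order \<open>sqrt (\<kappa> * 2 ^ k)\<close>; these errors grow geometrically, so
  their sum is a multiple of the last one.\<close>

lemma dyadic_subframes:
  fixes \<kappa> :: real
  assumes I: "finite I" and v: "\<And>j. j \<in> I \<Longrightarrow> v j \<in> carrier_vec N"
    and tight: "\<And>w. w \<in> carrier_vec N \<Longrightarrow> (\<Sum>j\<in>I. (cmod (w \<bullet>c v j))\<^sup>2) = (euclid_norm w)\<^sup>2"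
    and \<kappa>: "\<kappa> > 0" and small: "\<And>j. j \<in> I \<Longrightarrow> (euclid_norm (v j))\<^sup>2 \<le> \<kappa>"
    and k: "2500 * \<kappa> * 2 ^ k \<le> 1"
  shows "\<exists>J\<subseteq>I. real (card J) * 2 ^ k \<le> card I \<and> (\<forall>w\<in>carrier_vec N.
     (1 - 25 * sqrt (\<kappa> * 2 ^ k)) / 2 ^ k * (euclid_norm w)\<^sup>2 \<le> (\<Sum>j\<in>J. (cmod (w \<bullet>c v j))\<^sup>2) \<and>
     (\<Sum>j\<in>J. (cmod (w \<bullet>c v j))\<^sup>2) \<le> (1 + 25 * sqrt (\<kappa> * 2 ^ k)) / 2 ^ k * (euclid_norm w)\<^sup>2)"
  using k
proof (induction k)
  case 0
  have "(1 - 25 * sqrt \<kappa>) * x \<le> x \<and> x \<le> (1 + 25 * sqrt \<kappa>) * x" if "x \<ge> 0" for x :: real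
    using that \<kappa> by (simp add: algebra_simps)
  then show ?case using tight by (intro exI[of _ I]) auto
next
  case (Suc k)
  define r where "r = sqrt (\<kappa> * 2 ^ k)"
  define p where "p = 1 / (2::real) ^ k"
  have p: "p > 0" and r: "r > 0" using \<kappa> by (simp_all add: p_def r_def)
  have r2: "r\<^sup>2 = \<kappa> * 2 ^ k" using \<kappa> by (simp add: r_def)
  have "r\<^sup>2 \<le> (1 / 50)\<^sup>2" unfolding r2 using Suc.prems \<kappa> by (simp add: power2_eq_square)
  then have r50: "r \<le> 1 / 50" by (rule power2_le_imp_le) simp
  have "2500 * \<kappa> * 2 ^ k \<le> 2500 * \<kappa> * 2 ^ Suc k" using \<kappa> by simp
  then have "2500 * \<kappa> * 2 ^ k \<le> 1" using Suc.prems by linarith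
  from Suc.IH[OF this] obtain J where J: "J \<subseteq> I" "real (card J) * 2 ^ k \<le> card I"
    and lo: "\<And>w. w \<in> carrier_vec N \<Longrightarrow> (1 - 25 * r) * p * (euclid_norm w)\<^sup>2 \<le> (\<Sum>j\<in>J. (cmod (w \<bullet>c v j))\<^sup>2)"
    and up: "\<And>w. w \<in> carrier_vec N \<Longrightarrow> (\<Sum>j\<in>J. (cmod (w \<bullet>c v j))\<^sup>2) \<le> (1 + 25 * r) * p * (euclid_norm w)\<^sup>2"
    by (auto simp: r_def p_def)
  have finJ: "finite J" using J(1) I by (rule finite_subset)
  define \<alpha> where "\<alpha> = (1 - 25 * r) * p"
  have "1 / 2 * p \<le> \<alpha>" unfolding \<alpha>_def using r50 p by (intro mult_right_mono) auto
  then have \<alpha>_ge: "\<alpha> \<ge> p / 2" "\<alpha> > 0" using p by linarith+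
  interpret frame N J v \<alpha> "(1 + 25 * r) * p"
    using finJ J(1) v \<alpha>_ge(2) lo up by unfold_locales (auto simp: \<alpha>_def)
  \<comment> \<open>This is why \<open>\<eta> = 2 * r\<close>: since
    \<open>\<alpha> \<ge> p / 2\<close>, the admissible squared norm is at least
    \<open>r\<^sup>2 * p = \<kappa>\<close>.\<close>
  have "\<kappa> \<le> (2 * r)\<^sup>2 / 2 * \<alpha>"
  proof -
    have "\<kappa> = (2 * r)\<^sup>2 / 2 * (p / 2)" by (simp add: power_mult_distrib r2 p_def)
    also have "\<dots> \<le> (2 * r)\<^sup>2 / 2 * \<alpha>" using \<alpha>_ge(1) by (intro mult_left_mono) auto
    finally show ?thesis .
  qed
  then have "(euclid_norm (v j))\<^sup>2 \<le> (2 * r)\<^sup>2 / 2 * \<alpha>" if "j \<in> J" for j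
    using small[of j] J(1) that by auto
  then obtain S where S: "S \<subseteq> J"
    "\<And>w. w \<in> carrier_vec N \<Longrightarrow> (\<Sum>j\<in>S. (cmod (w \<bullet>c v j))\<^sup>2) \<le> (1 + 2 * r)\<^sup>2 / 2 * (\<Sum>j\<in>J. (cmod (w \<bullet>c v j))\<^sup>2)"
    "\<And>w. w \<in> carrier_vec N \<Longrightarrow> (\<Sum>j\<in>J - S. (cmod (w \<bullet>c v j))\<^sup>2) \<le> (1 + 2 * r)\<^sup>2 / 2 * (\<Sum>j\<in>J. (cmod (w \<bullet>c v j))\<^sup>2)"
    using balanced_partition[of "2 * r"] r by auto
  have "card S + card (J - S) = card J"
    using S(1) finJ by (metis card_Diff_subset card_mono finite_subset le_add_diff_inverse)
  \<comment> \<open>Both parts obey the same bound, so the smaller one may be kept.\<close>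
  then obtain T where T: "T = S \<or> T = J - S" "2 * card T \<le> card J"
    by (metis linorder_le_cases mult_2 add_le_cancel_left add_le_cancel_right)
  have TJ: "T \<subseteq> J" using T(1) S(1) by auto
  have T1: "(\<Sum>j\<in>T. (cmod (w \<bullet>c v j))\<^sup>2) \<le> (1 + 2 * r)\<^sup>2 / 2 * (\<Sum>j\<in>J. (cmod (w \<bullet>c v j))\<^sup>2)"
    and T2: "(\<Sum>j\<in>J - T. (cmod (w \<bullet>c v j))\<^sup>2) \<le> (1 + 2 * r)\<^sup>2 / 2 * (\<Sum>j\<in>J. (cmod (w \<bullet>c v j))\<^sup>2)"
    if "w \<in> carrier_vec N" for w
    using T(1) S(1) S(2,3)[OF that] by (auto simp: double_diff)
  have s2: "sqrt (\<kappa> * 2 ^ Suc k) = sqrt 2 * r" by (simp add: r_def real_sqrt_mult)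
  \<comment> \<open>The permitted error grows from \<open>25 * r\<close> to at least
    \<open>35 * r\<close>. One halving produces \<open>29 * r\<close> to first order, and
    \<open>r \<le> 1 / 50\<close> lets the slack absorb the higher-order terms.\<close>
  have "sqrt 2 \<ge> 7 / 5" by (rule real_le_rsqrt) (simp add: power2_eq_square)
  then have s: "25 * sqrt (\<kappa> * 2 ^ Suc k) \<ge> 35 * r" unfolding s2 using r by simp
  have p': "x / 2 ^ Suc k = x * (p / 2)" for x :: real by (simp add: p_def)
  have rr: "r * r \<le> r / 50" "r * (r * r) \<le> r / 2500"
    using mult_left_mono[OF r50, of r] mult_left_mono[OF mult_mono[OF r50 r50], of r] r by auto
  have "real (card T) * 2 ^ Suc k \<le> card I"
  proof -
    have "real (2 * card T) * 2 ^ k \<le> real (card J) * 2 ^ k"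
      using T(2) by (intro mult_right_mono) (simp_all only: of_nat_le_iff, simp)
    also have "\<dots> \<le> card I" by (rule J(2))
    finally show ?thesis by (simp add: mult_ac)
  qed
  moreover have "(1 - 25 * sqrt (\<kappa> * 2 ^ Suc k)) / 2 ^ Suc k * (euclid_norm w)\<^sup>2 \<le> (\<Sum>j\<in>T. (cmod (w \<bullet>c v j))\<^sup>2)"
    if w: "w \<in> carrier_vec N" for w
  proof -
    have "(2 - (1 + 2 * r)\<^sup>2) * (1 - 25 * r) = 1 - 29 * r + 96 * (r * r) + 100 * (r * (r * r))"
      by (simp add: power2_eq_square algebra_simps)
    then have num: "1 - 35 * r \<le> (2 - (1 + 2 * r)\<^sup>2) * (1 - 25 * r)"
      using r mult_pos_pos[OF r r] mult_pos_pos[OF r mult_pos_pos[OF r r]] by linarith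
    have "2 - (1 + 2 * r)\<^sup>2 = 1 - 4 * r - 4 * (r * r)"
      by (simp add: power2_eq_square algebra_simps)
    then have num2: "2 - (1 + 2 * r)\<^sup>2 \<ge> 0" using rr(1) r50 by linarith
    have "(1 - 25 * sqrt (\<kappa> * 2 ^ Suc k)) / 2 ^ Suc k * (euclid_norm w)\<^sup>2
       \<le> (2 - (1 + 2 * r)\<^sup>2) * (1 - 25 * r) * (p / 2) * (euclid_norm w)\<^sup>2"
      unfolding p' using num s p by (intro mult_right_mono) auto
    also have "\<dots> = (2 - (1 + 2 * r)\<^sup>2) / 2 * ((1 - 25 * r) * p * (euclid_norm w)\<^sup>2)" by simp
    also have "\<dots> \<le> (2 - (1 + 2 * r)\<^sup>2) / 2 * (\<Sum>j\<in>J. (cmod (w \<bullet>c v j))\<^sup>2)"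
      using num2 lo[OF w] by (intro mult_left_mono) auto
    also have "\<dots> = (\<Sum>j\<in>J. (cmod (w \<bullet>c v j))\<^sup>2) - (1 + 2 * r)\<^sup>2 / 2 * (\<Sum>j\<in>J. (cmod (w \<bullet>c v j))\<^sup>2)"
      by (simp add: algebra_simps diff_divide_distrib)
    \<comment> \<open>The lower bound for \<open>T\<close> is the upper bound for its
      complement.\<close>
    also have "\<dots> \<le> (\<Sum>j\<in>T. (cmod (w \<bullet>c v j))\<^sup>2)"
      using T2[OF w] sum.subset_diff[OF TJ finJ, of "\<lambda>j. (cmod (w \<bullet>c v j))\<^sup>2"] by linarith
    finally show ?thesis .
  qed
  moreover have "(\<Sum>j\<in>T. (cmod (w \<bullet>c v j))\<^sup>2) \<le> (1 + 25 * sqrt (\<kappa> * 2 ^ Suc k)) / 2 ^ Suc k * (euclid_norm w)\<^sup>2"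
    if w: "w \<in> carrier_vec N" for w
  proof -
    have "(1 + 2 * r)\<^sup>2 * (1 + 25 * r) = 1 + 29 * r + 104 * (r * r) + 100 * (r * (r * r))"
      by (simp add: power2_eq_square algebra_simps)
    then have num: "(1 + 2 * r)\<^sup>2 * (1 + 25 * r) \<le> 1 + 35 * r"
      using rr r by linarith
    have "(\<Sum>j\<in>T. (cmod (w \<bullet>c v j))\<^sup>2) \<le> (1 + 2 * r)\<^sup>2 / 2 * (\<Sum>j\<in>J. (cmod (w \<bullet>c v j))\<^sup>2)"
      by (rule T1[OF w])
    also have "\<dots> \<le> (1 + 2 * r)\<^sup>2 / 2 * ((1 + 25 * r) * p * (euclid_norm w)\<^sup>2)"
      using up[OF w] by (intro mult_left_mono) auto
    also have "\<dots> = (1 + 2 * r)\<^sup>2 * (1 + 25 * r) * (p / 2) * (euclid_norm w)\<^sup>2" by simp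
    also have "\<dots> \<le> (1 + 25 * sqrt (\<kappa> * 2 ^ Suc k)) / 2 ^ Suc k * (euclid_norm w)\<^sup>2"
      unfolding p' using num s p by (intro mult_right_mono) auto
    finally show ?thesis .
  qed
  ultimately show ?case using TJ J(1) by (intro exI[of _ T]) auto
qed

text \<open>With \<open>k\<close> maximal such that \<open>2500 * \<kappa> * 2 ^ k \<le> 1\<close>,
  the factor \<open>p = 1 / 2 ^ k\<close> lies between \<open>2500 * \<kappa>\<close> and
  \<open>5000 * \<kappa>\<close>, and the relative error is at most 1/2. This gives the upper
  constant \<open>3 / 2 * 5000 = 7500\<close>. If no such \<open>k\<close> exists,
  \<open>\<kappa>\<close> is bounded below and the whole system works.\<close>

lemma subframe_of_size:
  fixes \<kappa> :: real
  assumes I: "finite I" and v: "\<And>j. j \<in> I \<Longrightarrow> v j \<in> carrier_vec N"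
    and tight: "\<And>w. w \<in> carrier_vec N \<Longrightarrow> (\<Sum>j\<in>I. (cmod (w \<bullet>c v j))\<^sup>2) = (euclid_norm w)\<^sup>2"
    and \<kappa>: "0 < \<kappa>" "\<kappa> \<le> 1" and small: "\<And>j. j \<in> I \<Longrightarrow> (euclid_norm (v j))\<^sup>2 \<le> \<kappa>"
  obtains J where "J \<subseteq> I" "real (card J) \<le> 5000 * \<kappa> * card I"
    "\<And>w. w \<in> carrier_vec N \<Longrightarrow> \<kappa> * (euclid_norm w)\<^sup>2 \<le> (\<Sum>j\<in>J. (cmod (w \<bullet>c v j))\<^sup>2)"
    "\<And>w. w \<in> carrier_vec N \<Longrightarrow> (\<Sum>j\<in>J. (cmod (w \<bullet>c v j))\<^sup>2) \<le> 7500 * \<kappa> * (euclid_norm w)\<^sup>2"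
proof (cases "2500 * \<kappa> \<le> 1")
  case False
  have "real (card I) \<le> 5000 * \<kappa> * card I"
    using mult_right_mono[of 1 "5000 * \<kappa>" "real (card I)"] False by simp
  moreover have "\<kappa> * (euclid_norm w)\<^sup>2 \<le> (euclid_norm w)\<^sup>2" for w
    using mult_right_mono[OF \<kappa>(2), of "(euclid_norm w)\<^sup>2"] by simp
  moreover have "(euclid_norm w)\<^sup>2 \<le> 7500 * \<kappa> * (euclid_norm w)\<^sup>2" for w
    using mult_right_mono[of 1 "7500 * \<kappa>" "(euclid_norm w)\<^sup>2"] False by simp
  ultimately show thesis using that[of I] tight by simp
next
  case True
  let ?P = "\<lambda>k. 2500 * \<kappa> * 2 ^ k > 1"
  obtain n where "2 ^ n > 1 / (2500 * \<kappa>)" using real_arch_pow[of 2] by auto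
  then have Pn: "?P n" using \<kappa> by (simp add: field_simps)
  define m where "m = (LEAST k. ?P k)"
  have Pm: "?P m" unfolding m_def using Pn by (rule LeastI)
  have "m \<noteq> 0"
  proof
    assume "m = 0"
    then show False using Pm True by simp
  qed
  then obtain k where k: "m = Suc k" using not0_implies_Suc by blast
  have "\<not> ?P k" using not_less_Least[of k ?P] k by (simp add: m_def)
  then have le: "2500 * \<kappa> * 2 ^ k \<le> 1" by simp
  define p where "p = 1 / (2::real) ^ k"
  have p: "p > 0" "2500 * \<kappa> \<le> p" "p \<le> 5000 * \<kappa>"
    using le Pm unfolding k by (simp_all add: p_def field_simps)
  have "sqrt (\<kappa> * 2 ^ k) \<le> 1 / 50"
    using le by (intro real_le_lsqrt) (simp_all add: power2_eq_square)
  then have g: "25 * sqrt (\<kappa> * 2 ^ k) \<le> 1 / 2" by simp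
  obtain J where J: "J \<subseteq> I" "real (card J) * 2 ^ k \<le> card I"
    and lo: "\<And>w. w \<in> carrier_vec N \<Longrightarrow> (1 - 25 * sqrt (\<kappa> * 2 ^ k)) / 2 ^ k * (euclid_norm w)\<^sup>2 \<le> (\<Sum>j\<in>J. (cmod (w \<bullet>c v j))\<^sup>2)"
    and up: "\<And>w. w \<in> carrier_vec N \<Longrightarrow> (\<Sum>j\<in>J. (cmod (w \<bullet>c v j))\<^sup>2) \<le> (1 + 25 * sqrt (\<kappa> * 2 ^ k)) / 2 ^ k * (euclid_norm w)\<^sup>2"
    using dyadic_subframes[OF I v tight \<kappa>(1) small le] by blast
  show thesis
  proof (rule that[OF J(1)])
    have "real (card J) \<le> p * card I" using J(2) by (simp add: p_def field_simps)
    also have "\<dots> \<le> 5000 * \<kappa> * card I" using p(3) by (intro mult_right_mono) auto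
    finally show "real (card J) \<le> 5000 * \<kappa> * card I" .
    fix w :: "complex vec" assume w: "w \<in> carrier_vec N"
    have "1 / 2 * p \<le> (1 - 25 * sqrt (\<kappa> * 2 ^ k)) * p" using g p(1) by (intro mult_right_mono) auto
    then have "\<kappa> \<le> (1 - 25 * sqrt (\<kappa> * 2 ^ k)) / 2 ^ k" using p \<kappa> by (simp add: p_def)
    then have "\<kappa> * (euclid_norm w)\<^sup>2 \<le> (1 - 25 * sqrt (\<kappa> * 2 ^ k)) / 2 ^ k * (euclid_norm w)\<^sup>2"
      by (intro mult_right_mono) auto
    then show "\<kappa> * (euclid_norm w)\<^sup>2 \<le> (\<Sum>j\<in>J. (cmod (w \<bullet>c v j))\<^sup>2)" using lo[OF w] by linarith
    have "(1 + 25 * sqrt (\<kappa> * 2 ^ k)) * p \<le> 3 / 2 * p" using g p(1) by (intro mult_right_mono) auto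
    then have "(1 + 25 * sqrt (\<kappa> * 2 ^ k)) / 2 ^ k \<le> 7500 * \<kappa>" using p by (simp add: p_def)
    then have "(1 + 25 * sqrt (\<kappa> * 2 ^ k)) / 2 ^ k * (euclid_norm w)\<^sup>2 \<le> 7500 * \<kappa> * (euclid_norm w)\<^sup>2"
      by (intro mult_right_mono) auto
    then show "(\<Sum>j\<in>J. (cmod (w \<bullet>c v j))\<^sup>2) \<le> 7500 * \<kappa> * (euclid_norm w)\<^sup>2" using up[OF w] by linarith
  qed
qed

text \<open>For \<open>\<kappa> = \<theta> N / M\<close> the hypotheses become
  \<open>\<kappa> \<le> 1\<close> and squared norms at most \<open>\<kappa>\<close>; multiplying the
  bounds of \<open>subframe_of_size\<close> by \<open>M / N\<close> gives the claim.\<close>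

theorem lemma2p2:
  shows "\<exists>c0 C0 C1 :: real. c0 > 0 \<and> C0 > 0 \<and> C1 > 0 \<and>
    (\<forall>(N::nat) (M::nat) v (\<theta>::real).
       N \<ge> 1 \<longrightarrow>
       (\<forall>j\<in>{1..M}. v j \<in> carrier_vec N) \<longrightarrow>
       (\<forall>w\<in>carrier_vec N. (\<Sum>j\<in>{1..M}. (cmod (w \<bullet>c v j))\<^sup>2) = (euclid_norm w)\<^sup>2) \<longrightarrow>
       \<theta> \<le> real M / real N \<longrightarrow>
       (\<forall>j\<in>{1..M}. (euclid_norm (v j))\<^sup>2 \<le> \<theta> * real N / real M) \<longrightarrow>
       (\<exists>J\<subseteq>{1..M}. real (card J) \<le> C1 * \<theta> * real N \<and>
          (\<forall>w\<in>carrier_vec N.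
             c0 * \<theta> * (euclid_norm w)\<^sup>2 \<le> real M / real N * (\<Sum>j\<in>J. (cmod (w \<bullet>c v j))\<^sup>2) \<and>
             real M / real N * (\<Sum>j\<in>J. (cmod (w \<bullet>c v j))\<^sup>2) \<le> C0 * \<theta> * (euclid_norm w)\<^sup>2)))"
proof -
  have "\<exists>J\<subseteq>{1..M}. real (card J) \<le> 5000 * \<theta> * real N \<and>
          (\<forall>w\<in>carrier_vec N.
             1 * \<theta> * (euclid_norm w)\<^sup>2 \<le> real M / real N * (\<Sum>j\<in>J. (cmod (w \<bullet>c v j))\<^sup>2) \<and>
             real M / real N * (\<Sum>j\<in>J. (cmod (w \<bullet>c v j))\<^sup>2) \<le> 7500 * \<theta> * (euclid_norm w)\<^sup>2)"
    if N: "N \<ge> 1" and v: "\<forall>j\<in>{1..M}. v j \<in> carrier_vec N"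
      and tight: "\<forall>w\<in>carrier_vec N. (\<Sum>j\<in>{1..M}. (cmod (w \<bullet>c v j))\<^sup>2) = (euclid_norm w)\<^sup>2"
      and \<theta>: "\<theta> \<le> real M / real N"
      and small: "\<forall>j\<in>{1..M}. (euclid_norm (v j))\<^sup>2 \<le> \<theta> * real N / real M"
    for N M :: nat and v :: "nat \<Rightarrow> complex vec" and \<theta> :: real
  proof -
    define \<kappa> where "\<kappa> = \<theta> * real N / real M"
    \<comment> \<open>A nonzero test vector: the frame identity at \<open>e\<close> yields a nonzero
      \<open>v j\<close>, hence \<open>M \<ge> 1\<close> and \<open>\<kappa> > 0\<close>.\<close>
    define e where "e = (unit_vec N 0 :: complex vec)"
    have e: "e \<in> carrier_vec N" "e \<noteq> 0\<^sub>v N" using N by (auto simp: e_def unit_vec_eq)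
    have "(\<Sum>j\<in>{1..M}. (cmod (e \<bullet>c v j))\<^sup>2) > 0" using tight e euclid_norm_sq_pos[OF e] by simp
    then obtain j where j: "j \<in> {1..M}" "(cmod (e \<bullet>c v j))\<^sup>2 > 0"
      using sum_nonpos[of "{1..M}" "\<lambda>j. (cmod (e \<bullet>c v j))\<^sup>2"] by (meson not_le)
    have M: "M \<ge> 1" using j by simp
    have "0 < (euclid_norm (v j))\<^sup>2 * (euclid_norm e)\<^sup>2"
      using cscalar_prod_Cauchy_Schwarz[OF v[rule_format, OF j(1)] e(1)] j(2) by linarith
    then have "(euclid_norm (v j))\<^sup>2 > 0" using euclid_norm_sq_pos[OF e] by (simp add: zero_less_mult_iff)
    then have \<kappa>0: "\<kappa> > 0" using small j(1) unfolding \<kappa>_def by (meson less_le_trans)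
    have \<kappa>1: "\<kappa> \<le> 1" using \<theta> N M by (simp add: \<kappa>_def field_simps)
    obtain J where J: "J \<subseteq> {1..M}" "real (card J) \<le> 5000 * \<kappa> * card {1..M}"
      "\<And>w. w \<in> carrier_vec N \<Longrightarrow> \<kappa> * (euclid_norm w)\<^sup>2 \<le> (\<Sum>j\<in>J. (cmod (w \<bullet>c v j))\<^sup>2)"
      "\<And>w. w \<in> carrier_vec N \<Longrightarrow> (\<Sum>j\<in>J. (cmod (w \<bullet>c v j))\<^sup>2) \<le> 7500 * \<kappa> * (euclid_norm w)\<^sup>2"
      by (rule subframe_of_size[of "{1..M}" v N \<kappa>]) (use v tight small \<kappa>0 \<kappa>1 in \<open>auto simp: \<kappa>_def\<close>)
    have scale: "real M / real N * \<kappa> = \<theta>" using N M by (simp add: \<kappa>_def)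
    have "real (card J) \<le> 5000 * \<theta> * real N"
      using J(2) M by (simp add: \<kappa>_def)
    moreover have "1 * \<theta> * (euclid_norm w)\<^sup>2 \<le> real M / real N * (\<Sum>j\<in>J. (cmod (w \<bullet>c v j))\<^sup>2)"
      if "w \<in> carrier_vec N" for w
      using mult_left_mono[OF J(3)[OF that], of "real M / real N"] unfolding scale[symmetric] by (simp add: mult.assoc)
    moreover have "real M / real N * (\<Sum>j\<in>J. (cmod (w \<bullet>c v j))\<^sup>2) \<le> 7500 * \<theta> * (euclid_norm w)\<^sup>2"
      if "w \<in> carrier_vec N" for w
      using mult_left_mono[OF J(4)[OF that], of "real M / real N"] unfolding scale[symmetric] by (simp add: mult_ac)
    ultimately show ?thesis using J(1) by blast
  qed
  then show ?thesis by (intro exI[of _ 1] exI[of _ 7500] exI[of _ 5000] conjI allI impI) simp_all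
qed

end
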